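(* Let $T\in\mathcal{L}(\mathcal{H})$ be a contraction of class $C_0(N)$, let $\mathcal{U}$ be the set of unitary $N$-dilations of $T$ to $\mathcal{H}\oplus\mathbb{C}^N$ (unitary operators $\mathbf{U}$ on $\mathcal{H}\oplus\mathbb{C}^N$ with $P_{\mathcal{H}}\mathbf{U}|_{\mathcal{H}}=T$), and define $\tau:\mathcal{U}\to\mathfrak{K}$ by $\tau(\mathbf{U})=\overline{W(\mathbf{U})}$. Then $\tau$ wraps $\overline{W(T)}$. In particular, $\overline{W(T)}=\bigcap_{\mathbf{U}\in\mathcal{U}}\overline{W(\mathbf{U})}$.
   Context: A contraction $T$ on a separable Hilbert space $\mathcal{H}$ is of class $C_0(N)$ if $\dim\mathcal{D}_T=\dim\mathcal{D}_{T^*}=N<\infty$ (where $\mathcal{D}_T=\overline{\operatorname{ran}(I-T^*T)^{1/2}}$, $\mathcal{D}_{T^*}=\overline{\operatorname{ran}(I-TT^* )^{1/2}}$) and both $T^n$ and $T^{*n}$ tend strongly to $0$. $W$ denotes numerical range. $\mathfrak{K}$ is the space of nonempty compact subsets of $\mathbb{C}$ with the Hausdorff distance; $\mathcal{U}$ carries the operator norm topology (it is compact). A continuous $\tau$ wraps $A\in\mathfrak{K}$ if for every open half-plane $\mathbb{H}$ containing $A$ there exists $\mathbf{U}\in\mathcal{U}$ with $\tau(\mathbf{U})\subset\mathbb{H}$. *)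

theory Defs
  imports "HOL-Analysis.Analysis"
begin

text \<open>A complex inner product space: a real normed vector space with a complex scalar
  multiplication compatible with the real one, and a complex inner product that is
  linear in the first and conjugate-linear in the second argument and induces the norm.
  Hilbert spaces are obtained by adding the sort complete_space.\<close>

class complex_inner = real_normed_vector +
  fixes scaleC :: "complex \<Rightarrow> 'a \<Rightarrow> 'a"
  fixes cinner :: "'a \<Rightarrow> 'a \<Rightarrow> complex"
  assumes scaleC_add_right: "scaleC a (x + y) = scaleC a x + scaleC a y"
    and scaleC_add_left: "scaleC (a + b) x = scaleC a x + scaleC b x"
    and scaleC_scaleC: "scaleC a (scaleC b x) = scaleC (a * b) x"
    and scaleC_one: "scaleC 1 x = x"
    and scaleR_scaleC: "scaleR r x = scaleC (complex_of_real r) x"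
    and cinner_commute: "cinner x y = cnj (cinner y x)"
    and cinner_add_left: "cinner (x + y) z = cinner x z + cinner y z"
    and cinner_scaleC_left: "cinner (scaleC a x) y = a * cinner x y"
    and norm_cinner: "complex_of_real ((norm x)\<^sup>2) = cinner x x"

definition separable_space :: "'a::topological_space itself \<Rightarrow> bool" where
  "separable_space _ \<longleftrightarrow> (\<exists>D::'a set. countable D \<and> closure D = UNIV)"

definition clinear_op :: "('a::complex_inner \<Rightarrow> 'a) \<Rightarrow> bool" where
  "clinear_op f \<longleftrightarrow> (\<forall>x y. f (x + y) = f x + f y) \<and> (\<forall>c x. f (scaleC c x) = scaleC c (f x))"

definition bounded_op :: "('a::complex_inner \<Rightarrow> 'a) \<Rightarrow> bool" where
  "bounded_op f \<longleftrightarrow> clinear_op f \<and> (\<exists>K. \<forall>x. norm (f x) \<le> K * norm x)"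

definition contraction :: "('a::complex_inner \<Rightarrow> 'a) \<Rightarrow> bool" where
  "contraction T \<longleftrightarrow> bounded_op T \<and> (\<forall>x. norm (T x) \<le> norm x)"

definition adjoint :: "('a::complex_inner \<Rightarrow> 'a) \<Rightarrow> ('a \<Rightarrow> 'a)" where
  "adjoint T = (THE S. \<forall>x y. cinner (T x) y = cinner x (S y))"

definition positive_op :: "('a::complex_inner \<Rightarrow> 'a) \<Rightarrow> bool" where
  "positive_op S \<longleftrightarrow> clinear_op S \<and> (\<forall>x. Im (cinner (S x) x) = 0 \<and> Re (cinner (S x) x) \<ge> 0)"

definition op_sqrt :: "('a::complex_inner \<Rightarrow> 'a) \<Rightarrow> ('a \<Rightarrow> 'a)" where
  "op_sqrt A = (THE S. positive_op S \<and> (\<forall>x. S (S x) = A x))"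

definition defect_space :: "('a::complex_inner \<Rightarrow> 'a) \<Rightarrow> 'a set" where
  "defect_space T = closure (range (op_sqrt (\<lambda>x. x - adjoint T (T x))))"

definition cdim_eq :: "'a::complex_inner set \<Rightarrow> nat \<Rightarrow> bool" where
  "cdim_eq D N \<longleftrightarrow> (\<exists>B. finite B \<and> card B = N \<and> module.independent scaleC B
                         \<and> module.span scaleC B = D)"

definition class_C0N :: "('a::complex_inner \<Rightarrow> 'a) \<Rightarrow> nat \<Rightarrow> bool" where
  "class_C0N T N \<longleftrightarrow> contraction T
     \<and> cdim_eq (defect_space T) N \<and> cdim_eq (defect_space (adjoint T)) N
     \<and> (\<forall>x. (\<lambda>n. (T ^^ n) x) \<longlonglongrightarrow> 0)
     \<and> (\<forall>x. (\<lambda>n. (adjoint T ^^ n) x) \<longlonglongrightarrow> 0)"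

text \<open>C^N is complex^'n with CARD('n) = N; its (Euclidean) norm is the library norm.\<close>
definition cvinner :: "complex^'n \<Rightarrow> complex^'n \<Rightarrow> complex" where
  "cvinner v w = (\<Sum>i\<in>UNIV. v $ i * cnj (w $ i))"

text \<open>Inner product of the orthogonal direct sum H \<oplus> C^N, modelled as the product type
  (whose library norm is sqrt(norm h ^ 2 + norm v ^ 2)).\<close>
definition dsinner :: "'a::complex_inner \<times> (complex^'n) \<Rightarrow> 'a \<times> (complex^'n) \<Rightarrow> complex" where
  "dsinner x y = cinner (fst x) (fst y) + cvinner (snd x) (snd y)"

definition unitary_ds :: "('a::complex_inner \<times> (complex^'n) \<Rightarrow> 'a \<times> (complex^'n)) \<Rightarrow> bool" where
  "unitary_ds U \<longleftrightarrow> (\<exists>S. (\<forall>x y. dsinner (U x) y = dsinner x (S y))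
                        \<and> (\<forall>x. S (U x) = x) \<and> (\<forall>x. U (S x) = x))"

definition dilations :: "('a::complex_inner \<Rightarrow> 'a) \<Rightarrow> ('a \<times> (complex^'n) \<Rightarrow> 'a \<times> (complex^'n)) set" where
  "dilations T = {U. unitary_ds U \<and> (\<forall>h. fst (U (h, 0)) = T h)}"

definition num_range :: "('a::complex_inner \<Rightarrow> 'a) \<Rightarrow> complex set" where
  "num_range T = {cinner (T x) x | x. norm x = 1}"

definition num_range_ds :: "('a::complex_inner \<times> (complex^'n) \<Rightarrow> 'a \<times> (complex^'n)) \<Rightarrow> complex set" where
  "num_range_ds U = {dsinner (U x) x | x. norm x = 1}"

definition hausdorff_dist :: "'a::metric_space set \<Rightarrow> 'a set \<Rightarrow> real" where
  "hausdorff_dist A B = max (SUP a\<in>A. infdist a B) (SUP b\<in>B. infdist b A)"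

definition wraps :: "(('b::real_normed_vector \<Rightarrow> 'b) \<Rightarrow> complex set) \<Rightarrow> ('b \<Rightarrow> 'b) set
                      \<Rightarrow> complex set \<Rightarrow> bool" where
  "wraps \<tau> \<U> A \<longleftrightarrow>
     (\<forall>U\<in>\<U>. \<forall>\<epsilon>>0. \<exists>\<delta>>0. \<forall>V\<in>\<U>. onorm (\<lambda>x. U x - V x) < \<delta> \<longrightarrow> hausdorff_dist (\<tau> U) (\<tau> V) < \<epsilon>)
   \<and> (\<forall>a c. a \<noteq> 0 \<and> A \<subseteq> {z. Re (a * z) < c} \<longrightarrow> (\<exists>U\<in>\<U>. \<tau> U \<subseteq> {z. Re (a * z) < c}))"

end

(* A dilation adapted to a half-plane is given by an explicit formula.  After a rotation let
   Re W(T) <= c' < c < 1, choose a unimodular m with Re m = c and put S = m - T, which is coercive and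
   hence invertible.  The operator S^{-*} (1 - T* T) S^{-1} is positive of rank at most N, so it equals
   L L* for some L : C^N -> H.  With J(h, v) = h - L v the operator U = m - J* S J is a unitary
   dilation of T, and <U z, z> = m |z|^2 - <S J z, J z> shows Re W(U) <= c.  If no such c < 1 exists,
   any dilation will do, and the Julia operator provides one; its unitarity rests on the intertwining
   of the two defect operators, read off from the binomial series of sqrt (1 - x).  The intersection
   formula follows by separation, W(T) being convex by the Toeplitz--Hausdorff theorem. *)
theory Submission
  imports Defs
begin

subsection \<open>Complex inner product spaces\<close>

text \<open>The formula for U is forced once m is required to be an eigenvalue with an eigenspace of
  the form {(L v, v)}. The normal operator m - U then vanishes on that space and has its range in
  the orthogonal complement {(g, - L* g)}; since its corner on H is S, it can only be J* S J. As J
  J* = 1 + L L*, the equation U* U = 1 amounts to S* S + S* L L* S = cnj m S + m S*. For S = m - T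
  with |m| = 1 the difference of cnj m S + m S* and S* S is 1 - T* T, and this dictates L.
  Coercivity of S asks for Re m above the supremum of Re W(T). A unimodular m cannot satisfy this
  when the supremum is 1. In that case the half-plane contains the closed unit disc and hence every
  W(U), but it still has to be shown that a dilation exists at all; this is why a second
  construction is present.\<close>

interpretation cvs: vector_space "scaleC :: complex \<Rightarrow> 'a \<Rightarrow> 'a::complex_inner"
  by unfold_locales (simp_all add: scaleC_add_right scaleC_add_left scaleC_scaleC scaleC_one)

lemma cinner_add_right: "cinner x (y + z) = cinner x y + cinner x z"
  for x y z :: "'a::complex_inner"
  by (metis cinner_commute cinner_add_left complex_cnj_add)

lemma cinner_scaleC_right: "cinner x (scaleC a y) = cnj a * cinner x y"
  for x y :: "'a::complex_inner"
  by (metis cinner_commute cinner_scaleC_left complex_cnj_mult)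

lemma cinner_zero_left [simp]: "cinner 0 y = 0" for y :: "'a::complex_inner"
  using cinner_add_left[of 0 0 y] by simp

lemma cinner_zero_right [simp]: "cinner y 0 = 0" for y :: "'a::complex_inner"
  using cinner_add_right[of y 0 0] by simp

lemma cinner_minus_left [simp]: "cinner (- x) y = - cinner x y" for x y :: "'a::complex_inner"
  using cinner_add_left[of x "- x" y] by (simp add: eq_neg_iff_add_eq_0 add.commute)

lemma cinner_minus_right [simp]: "cinner x (- y) = - cinner x y" for x y :: "'a::complex_inner"
  using cinner_add_right[of x y "- y"] by (simp add: eq_neg_iff_add_eq_0 add.commute)

lemma cinner_diff_left: "cinner (x - y) z = cinner x z - cinner y z"
  for x y z :: "'a::complex_inner"
  using cinner_add_left[of x "- y" z] by simp

lemma cinner_diff_right: "cinner x (y - z) = cinner x y - cinner x z"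
  for x y z :: "'a::complex_inner"
  using cinner_add_right[of x y "- z"] by simp

lemma cinner_scaleR_left: "cinner (r *\<^sub>R x) y = of_real r * cinner x y"
  for x y :: "'a::complex_inner"
  by (simp add: scaleR_scaleC cinner_scaleC_left)

lemma cinner_scaleR_right: "cinner x (r *\<^sub>R y) = of_real r * cinner x y"
  for x y :: "'a::complex_inner"
  by (simp add: scaleR_scaleC cinner_scaleC_right)

lemma cinner_sum_left: "cinner (\<Sum>i\<in>A. f i) y = (\<Sum>i\<in>A. cinner (f i) y)"
  for y :: "'a::complex_inner"
  by (induction A rule: infinite_finite_induct) (simp_all add: cinner_add_left)

lemma cinner_sum_right: "cinner y (\<Sum>i\<in>A. f i) = (\<Sum>i\<in>A. cinner y (f i))"
  for y :: "'a::complex_inner"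
  by (induction A rule: infinite_finite_induct) (simp_all add: cinner_add_right)

lemmas cinner_simps = cinner_add_left cinner_add_right cinner_diff_left cinner_diff_right
  cinner_scaleC_left cinner_scaleC_right cinner_scaleR_left cinner_scaleR_right
  cinner_sum_left cinner_sum_right

lemma cinner_self: "cinner x x = complex_of_real ((norm x)\<^sup>2)" for x :: "'a::complex_inner"
  by (rule norm_cinner[symmetric])

lemma cinner_eqI:
  assumes "\<And>y. cinner x y = cinner z y"
  shows "x = (z::'a::complex_inner)"
proof -
  have "cinner (x - z) (x - z) = 0"
    using assms[of "x - z"] by (simp add: cinner_diff_left)
  then show ?thesis by (simp add: cinner_self)
qed

lemma Re_cinner_commute: "Re (cinner x y) = Re (cinner y x)" for x y :: "'a::complex_inner"
  by (subst cinner_commute) simp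

lemma norm_add_cinner: "(norm (x + y))\<^sup>2 = (norm x)\<^sup>2 + 2 * Re (cinner x y) + (norm y)\<^sup>2"
  for x y :: "'a::complex_inner"
proof -
  have "complex_of_real ((norm (x + y))\<^sup>2)
      = of_real ((norm x)\<^sup>2) + (cinner x y + cinner y x) + of_real ((norm y)\<^sup>2)"
    unfolding norm_cinner cinner_simps by simp
  from arg_cong[OF this, of Re] show ?thesis
    using Re_cinner_commute[of x y] by simp
qed

lemma norm_diff_cinner: "(norm (x - y))\<^sup>2 = (norm x)\<^sup>2 - 2 * Re (cinner x y) + (norm y)\<^sup>2"
  for x y :: "'a::complex_inner"
  using norm_add_cinner[of x "- y"] by simp

lemma norm_scaleC [simp]: "norm (scaleC a x) = cmod a * norm x" for x :: "'a::complex_inner"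
proof -
  have "complex_of_real ((norm (scaleC a x))\<^sup>2) = a * cnj a * complex_of_real ((norm x)\<^sup>2)"
    by (simp add: norm_cinner cinner_scaleC_left cinner_scaleC_right del: of_real_power)
  also have "\<dots> = of_real ((cmod a * norm x)\<^sup>2)"
    by (simp add: complex_norm_square[symmetric] power_mult_distrib del: of_real_power)
  finally have "(norm (scaleC a x))\<^sup>2 = (cmod a * norm x)\<^sup>2"
    by (simp only: of_real_eq_iff)
  then show ?thesis by (simp add: power2_eq_iff_nonneg)
qed

text \<open>The class supplies the triangle inequality of the norm, so Cauchy-Schwarz comes from
  squaring it. The complex version follows by rotating the phase of \<open>x\<close>.\<close>

lemma Re_cinner_le: "Re (cinner x y) \<le> norm x * norm y" for x y :: "'a::complex_inner"
proof -
  have "(norm (x + y))\<^sup>2 \<le> (norm x + norm y)\<^sup>2"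
    by (simp add: norm_triangle_ineq power_mono)
  then show ?thesis unfolding norm_add_cinner by (simp add: power2_sum)
qed

lemma cmod_cinner_le: "cmod (cinner x y) \<le> norm x * norm y" for x y :: "'a::complex_inner"
proof (cases "cinner x y = 0")
  case False
  define u where "u = cnj (cinner x y) / of_real (cmod (cinner x y))"
  have u: "cmod u = 1" using False by (simp add: u_def norm_divide)
  have "cinner (scaleC u x) y = of_real (cmod (cinner x y))"
    using False complex_norm_square[of "cinner x y"]
    by (simp add: cinner_simps u_def field_simps power2_eq_square)
  then show ?thesis using Re_cinner_le[of "scaleC u x" y] u by simp
qed simp

text \<open>With these instances the inner product of \<open>H \<oplus> C^N\<close> is an instance of cinner.\<close>

instantiation complex :: complex_inner
begin
definition scaleC_complex :: "complex \<Rightarrow> complex \<Rightarrow> complex" where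
  "scaleC_complex a x = a * x"
definition cinner_complex :: "complex \<Rightarrow> complex \<Rightarrow> complex" where
  "cinner_complex x y = x * cnj y"
instance
  by standard (simp_all add: scaleC_complex_def cinner_complex_def algebra_simps
      scaleR_conv_of_real complex_norm_square del: of_real_power)
end

instantiation vec :: (complex_inner, finite) complex_inner
begin
definition scaleC_vec :: "complex \<Rightarrow> 'a ^ 'b \<Rightarrow> 'a ^ 'b" where
  "scaleC_vec a x = (\<chi> i. scaleC a (x $ i))"
definition cinner_vec :: "'a ^ 'b \<Rightarrow> 'a ^ 'b \<Rightarrow> complex" where
  "cinner_vec x y = (\<Sum>i\<in>UNIV. cinner (x $ i) (y $ i))"
instance
proof
  fix x y z :: "'a ^ 'b" and a b :: complex and r :: real
  show "cinner x y = cnj (cinner y x)"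
    unfolding cinner_vec_def cnj_sum by (intro sum.cong refl cinner_commute)
  show "complex_of_real ((norm x)\<^sup>2) = cinner x x"
    by (simp add: cinner_vec_def norm_vec_def L2_set_def sum_nonneg cinner_self del: of_real_power)
qed (simp_all add: scaleC_vec_def cinner_vec_def vec_eq_iff scaleC_add_right scaleC_add_left
      scaleC_scaleC scaleC_one scaleR_scaleC cinner_simps sum.distrib sum_distrib_left)
end

instantiation prod :: (complex_inner, complex_inner) complex_inner
begin
definition scaleC_prod :: "complex \<Rightarrow> 'a \<times> 'b \<Rightarrow> 'a \<times> 'b" where
  "scaleC_prod a x = (scaleC a (fst x), scaleC a (snd x))"
definition cinner_prod :: "'a \<times> 'b \<Rightarrow> 'a \<times> 'b \<Rightarrow> complex" where
  "cinner_prod x y = cinner (fst x) (fst y) + cinner (snd x) (snd y)"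
instance
proof
  fix x y z :: "'a \<times> 'b" and a b :: complex and r :: real
  show "cinner x y = cnj (cinner y x)"
    unfolding cinner_prod_def complex_cnj_add by (intro arg_cong2[of _ _ _ _ "(+)"] cinner_commute)
  show "complex_of_real ((norm x)\<^sup>2) = cinner x x"
    by (simp add: cinner_prod_def norm_prod_def cinner_self del: of_real_power of_real_add
        add: of_real_add[symmetric])
qed (simp_all add: scaleC_prod_def cinner_prod_def prod_eq_iff scaleC_add_right scaleC_add_left
      scaleC_scaleC scaleC_one scaleR_scaleC cinner_simps algebra_simps)
end

lemma dsinner_eq_cinner: "dsinner x y = cinner x y"
  by (simp add: dsinner_def cvinner_def cinner_prod_def cinner_vec_def cinner_complex_def)

subsection \<open>Adjoints\<close>

text \<open>Operators are carried along with a named adjoint rather than through the description in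
  \<open>adjoint\<close>. The relation makes both maps linear and makes sense between different
  spaces, as for \<open>J\<close> and \<open>synthesis\<close>.\<close>

definition adjoint_pair :: "('a::complex_inner \<Rightarrow> 'b::complex_inner) \<Rightarrow> ('b \<Rightarrow> 'a) \<Rightarrow> bool" where
  "adjoint_pair T T' \<longleftrightarrow> (\<forall>x y. cinner (T x) y = cinner x (T' y))"

lemma adjoint_pairD: "adjoint_pair T T' \<Longrightarrow> cinner (T x) y = cinner x (T' y)"
  by (simp add: adjoint_pair_def)

lemma adjoint_pair_sym: "adjoint_pair T T' \<Longrightarrow> adjoint_pair T' T"
  unfolding adjoint_pair_def by (metis cinner_commute)

lemma adjoint_pair_add: "adjoint_pair T T' \<Longrightarrow> T (x + y) = T x + T y"
  by (rule cinner_eqI) (simp add: adjoint_pairD cinner_simps)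

lemma adjoint_pair_diff: "adjoint_pair T T' \<Longrightarrow> T (x - y) = T x - T y"
  by (rule cinner_eqI) (simp add: adjoint_pairD cinner_simps)

lemma adjoint_pair_minus: "adjoint_pair T T' \<Longrightarrow> T (- x) = - T x"
  by (rule cinner_eqI) (simp add: adjoint_pairD)

lemma adjoint_pair_scaleC: "adjoint_pair T T' \<Longrightarrow> T (scaleC c x) = scaleC c (T x)"
  by (rule cinner_eqI) (simp add: adjoint_pairD cinner_simps)

lemma adjoint_pair_zero: "adjoint_pair T T' \<Longrightarrow> T 0 = 0"
  by (rule cinner_eqI) (simp add: adjoint_pairD)

lemma adjoint_pair_sum: "adjoint_pair T T' \<Longrightarrow> T (\<Sum>i\<in>A. f i) = (\<Sum>i\<in>A. T (f i))"
  by (rule cinner_eqI) (simp add: adjoint_pairD cinner_simps)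

lemmas adjoint_pair_linear =
  adjoint_pair_add adjoint_pair_diff adjoint_pair_minus adjoint_pair_scaleC adjoint_pair_zero adjoint_pair_sum

lemma adjoint_pair_clinear: "adjoint_pair T T' \<Longrightarrow> clinear_op T"
  by (simp add: clinear_op_def adjoint_pair_linear)

lemma adjoint_eqI: "adjoint T = T'" if "adjoint_pair T T'"
  unfolding adjoint_def
proof (rule the_equality)
  show "\<forall>x y. cinner (T x) y = cinner x (T' y)"
    using that by (simp add: adjoint_pair_def)
  show "S = T'" if "\<forall>x y. cinner (T x) y = cinner x (S y)" for S
  proof (rule ext, rule cinner_eqI)
    have "adjoint_pair T S" using that by (simp add: adjoint_pair_def)
    then show "cinner (S y) x = cinner (T' y) x" for x y
      using \<open>adjoint_pair T T'\<close> by (metis adjoint_pairD adjoint_pair_sym)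
  qed
qed

lemma adjoint_pair_contraction:
  assumes "adjoint_pair T T'" and "\<And>x. norm (T x) \<le> norm x"
  shows "norm (T' x) \<le> norm x"
proof -
  have "(norm (T' x))\<^sup>2 = Re (cinner (T (T' x)) x)"
    using assms(1) by (simp add: adjoint_pairD cinner_self)
  also have "\<dots> \<le> norm (T (T' x)) * norm x" by (rule Re_cinner_le)
  also have "\<dots> \<le> norm (T' x) * norm x" by (simp add: assms(2) mult_right_mono)
  finally have "norm (T' x) * norm (T' x) \<le> norm (T' x) * norm x"
    by (simp add: power2_eq_square)
  then show ?thesis
    by (cases "norm (T' x) = 0") (simp_all add: mult_le_cancel_left)
qed

subsection \<open>Riesz representation and coercive operators\<close>

text \<open>The first-order condition at a minimum. It yields the variational equation in the Riesz
  lemma and identifies the kernel of a positive form.\<close>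

lemma linear_coeff_zero:
  fixes a b :: real
  assumes "\<And>t. 0 \<le> 2 * t * a + t\<^sup>2 * b"
  shows "a = 0"
proof (rule ccontr)
  assume "a \<noteq> 0"
  \<comment> \<open>At t = - s a the factor s b - 2 is negative whatever the sign of b.\<close>
  define s where "s = 1 / (\<bar>b\<bar> + 1)"
  have s: "s > 0" "s * b \<le> 1" by (auto simp: s_def field_simps)
  have "2 * (- s * a) * a + (- s * a)\<^sup>2 * b = s * a\<^sup>2 * (s * b - 2)"
    by (simp add: power2_eq_square algebra_simps)
  moreover have "s * a\<^sup>2 * (s * b - 2) < 0"
    using s \<open>a \<noteq> 0\<close> by (intro mult_pos_neg) auto
  ultimately show False using assms[of "- s * a"] by linarith
qed

text \<open>The representing vector is the minimiser of the strictly convex functional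
  \<open>J\<close>; completeness makes a minimising sequence converge.\<close>

lemma riesz_representation:
  fixes f :: "'a::{complex_inner, complete_space} \<Rightarrow> complex"
  assumes add: "\<And>x y. f (x + y) = f x + f y"
    and scale: "\<And>c x. f (scaleC c x) = c * f x"
    and bound: "\<And>x. cmod (f x) \<le> K * norm x"
  obtains z where "\<And>x. f x = cinner x z"
proof -
  define J where "J x = (norm x)\<^sup>2 - 2 * Re (f x)" for x
  have scaleR: "f (r *\<^sub>R x) = of_real r * f x" for r x
    by (simp add: scaleR_scaleC scale)
  have diff: "f (x - y) = f x - f y" for x y
    using add[of "x - y" y] by simp
  have "J x \<ge> - K\<^sup>2" for x
  proof -
    have "Re (f x) \<le> K * norm x" using bound[of x] complex_Re_le_cmod[of "f x"] by linarith
    moreover have "0 \<le> (norm x - K)\<^sup>2" by simp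
    ultimately show ?thesis unfolding J_def by (simp add: power2_diff algebra_simps)
  qed
  then have bdd: "bdd_below (range J)" by (meson bdd_belowI2)
  define m where "m = Inf (range J)"
  have mle: "m \<le> J x" for x unfolding m_def by (rule cInf_lower) (auto simp: bdd)
  have "\<exists>x. J x < m + 1 / real (Suc n)" for n
    using cInf_lessD[of "range J" "m + 1 / real (Suc n)"] by (auto simp: m_def)
  then obtain X where X: "\<And>n. J (X n) < m + 1 / real (Suc n)" by metis
  \<comment> \<open>Parallelogram identity: the contributions of \<open>f\<close> cancel, so two
    points that are minimal up to e^2/4 are less than e apart.\<close>
  have par: "(norm (x - y))\<^sup>2 = 2 * J x + 2 * J y - 4 * J ((1/2) *\<^sub>R (x + y))" for x y
    unfolding J_def norm_scaleR scaleR add norm_add_cinner norm_diff_cinner power_mult_distrib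
    by (simp add: power2_eq_square algebra_simps)
  have "Cauchy X"
  proof (rule CauchyI)
    fix e :: real assume "e > 0"
    obtain M :: nat where "4 / e\<^sup>2 < real M"
      using reals_Archimedean2 by blast
    then have M: "4 / e\<^sup>2 < real (Suc M)" by simp
    have *: "1 / real (Suc k) < e\<^sup>2 / 4" if "k \<ge> M" for k
    proof -
      have "4 / e\<^sup>2 < real (Suc k)" using M that by (simp add: less_le_trans)
      then show ?thesis using \<open>e > 0\<close> by (simp add: field_simps)
    qed
    show "\<exists>M. \<forall>i\<ge>M. \<forall>k\<ge>M. norm (X i - X k) < e"
    proof (intro exI allI impI)
      fix i k assume "i \<ge> M" "k \<ge> M"
      then have "(norm (X i - X k))\<^sup>2 < e\<^sup>2"
        using par[of "X i" "X k"] X[of i] X[of k] mle[of "(1/2) *\<^sub>R (X i + X k)"] *[of i] *[of k]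
        by linarith
      then show "norm (X i - X k) < e" using \<open>e > 0\<close> by (simp add: power2_less_imp_less)
    qed
  qed
  then obtain z where z: "X \<longlonglongrightarrow> z"
    using Cauchy_convergent convergent_def by blast
  have fz: "(\<lambda>n. f (X n)) \<longlonglongrightarrow> f z"
  proof (rule Lim_null[THEN iffD2], rule Lim_null_comparison)
    show "\<forall>\<^sub>F n in sequentially. norm (f (X n) - f z) \<le> K * norm (X n - z)"
      using bound by (simp add: diff[symmetric])
    show "(\<lambda>n. K * norm (X n - z)) \<longlonglongrightarrow> 0"
      using z by (simp add: LIM_zero tendsto_norm_zero tendsto_mult_right_zero)
  qed
  have "(\<lambda>n. J (X n)) \<longlonglongrightarrow> J z"
    unfolding J_def by (intro tendsto_intros z fz)
  moreover have "(\<lambda>n. m + 1 / real (Suc n)) \<longlonglongrightarrow> m + 0"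
    by (intro tendsto_add tendsto_const LIMSEQ_Suc[OF lim_inverse_n'])
  ultimately have "J z \<le> m + 0"
    by (rule LIMSEQ_le) (use X less_imp_le in blast)
  then have Jz: "J z \<le> J x" for x using mle[of x] by linarith
  have Re_eq: "Re (f x) = Re (cinner x z)" for x
  proof -
    have "0 \<le> 2 * t * (Re (cinner z x) - Re (f x)) + t\<^sup>2 * (norm x)\<^sup>2" for t
      using Jz[of "z + t *\<^sub>R x"] unfolding J_def add scaleR norm_add_cinner
      by (simp add: cinner_scaleR_right power_mult_distrib algebra_simps)
    then have "Re (cinner z x) - Re (f x) = 0" by (rule linear_coeff_zero)
    then show ?thesis using Re_cinner_commute[of x z] by simp
  qed
  have "f x = cinner x z" for x
  proof (rule complex_eqI)
    show "Re (f x) = Re (cinner x z)" by (rule Re_eq)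
    show "Im (f x) = Im (cinner x z)"
      using Re_eq[of "scaleC \<i> x"] by (simp add: scale cinner_simps)
  qed
  then show ?thesis by (rule that)
qed

text \<open>Riesz is applied to the conjugate of \<open>s x\<close>, which is linear, for each
  \<open>x\<close> separately. Linearity of \<open>F\<close> is recovered later from adjoint
  pairs.\<close>

lemma form_representation:
  fixes s :: "'b \<Rightarrow> 'a::{complex_inner, complete_space} \<Rightarrow> complex"
  assumes add: "\<And>x y z. s x (y + z) = s x y + s x z"
    and scale: "\<And>c x y. s x (scaleC c y) = cnj c * s x y"
    and bound: "\<And>x y. cmod (s x y) \<le> K x * norm y"
  obtains F where "\<And>x y. s x y = cinner (F x) y"
proof -
  have "\<exists>z. \<forall>y. s x y = cinner z y" for x
  proof -
    obtain z where "\<And>y. cnj (s x y) = cinner y z"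
      by (rule riesz_representation[of "\<lambda>y. cnj (s x y)" "K x"])
        (simp_all add: add scale bound)
    then show ?thesis by (metis cinner_commute complex_cnj_cnj)
  qed
  then show ?thesis using that by metis
qed

lemma adjoint_pair_exists:
  fixes T :: "'a::{complex_inner, complete_space} \<Rightarrow> 'b::complex_inner"
  assumes add: "\<And>x y. T (x + y) = T x + T y"
    and scale: "\<And>c x. T (scaleC c x) = scaleC c (T x)"
    and bound: "\<And>x. norm (T x) \<le> K * norm x"
  obtains T' where "adjoint_pair T T'"
proof -
  have b: "cmod (cinner x (T y)) \<le> norm x * K * norm y" for x y
    using cmod_cinner_le[of x "T y"] mult_left_mono[OF bound[of y] norm_ge_zero[of x]]
    by (simp add: mult.assoc)
  obtain T' where "\<And>x y. cinner x (T y) = cinner (T' x) y"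
    by (rule form_representation[of "\<lambda>x y. cinner x (T y)"])
      (auto simp: add scale cinner_simps intro: b)
  then have "adjoint_pair T' T" by (simp add: adjoint_pair_def)
  then show ?thesis using that adjoint_pair_sym by blast
qed

text \<open>A Lax-Milgram argument: solutions of S x = y are the fixed points of x - t \<omega> (S x
  - y), and coercivity makes this map a strict contraction for small t.\<close>

lemma coercive_surj:
  fixes S :: "'a::{complex_inner, complete_space} \<Rightarrow> 'a"
  assumes diff: "\<And>x y. S (x - y) = S x - S y"
    and bound: "\<And>x. norm (S x) \<le> M * norm x"
    and coercive: "\<And>x. Re (\<omega> * cinner (S x) x) \<ge> \<kappa> * (norm x)\<^sup>2"
    and \<kappa>: "\<kappa> > 0" and \<omega>: "cmod \<omega> = 1"
  obtains x where "S x = y"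
proof -
  \<comment> \<open>The maximum makes \<open>N\<close> positive and at least
    \<open>\<kappa>\<close>, so that the root defining \<open>c\<close> is taken of a nonnegative
    number.\<close>
  define N where "N = max M \<kappa>"
  have N: "N > 0" "\<kappa> \<le> N" "M \<le> N" using \<kappa> by (auto simp: N_def)
  have boundN: "norm (S x) \<le> N * norm x" for x
    using bound[of x] N mult_right_mono[of M N "norm x"] by simp
  \<comment> \<open>This \<open>t\<close> minimises 1 - 2 t \<kappa> + t^2 N^2; the minimum is the
    square of \<open>c\<close>.\<close>
  define t where "t = \<kappa> / N\<^sup>2"
  define c where "c = sqrt (1 - (\<kappa> / N)\<^sup>2)"
  have "0 < (\<kappa> / N)\<^sup>2" "(\<kappa> / N)\<^sup>2 \<le> 1"
    using \<kappa> N by (auto simp: power_le_one)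
  then have c: "0 \<le> c" "c < 1" "c\<^sup>2 = 1 - (\<kappa> / N)\<^sup>2" by (simp_all add: c_def)
  define \<Phi> where "\<Phi> x = x - t *\<^sub>R scaleC \<omega> (S x - y)" for x
  have "dist (\<Phi> x) (\<Phi> x') \<le> c * dist x x'" for x x'
  proof -
    define u where "u = x - x'"
    have \<Phi>u: "\<Phi> x - \<Phi> x' = u - t *\<^sub>R scaleC \<omega> (S u)"
      by (simp add: \<Phi>_def u_def diff algebra_simps cvs.scale_right_diff_distrib)
    have "Re (cinner u (scaleC \<omega> (S u))) = Re (\<omega> * cinner (S u) u)"
      using Re_cinner_commute[of u "scaleC \<omega> (S u)"] by (simp add: cinner_scaleC_left)
    then have "(norm (\<Phi> x - \<Phi> x'))\<^sup>2 = (norm u)\<^sup>2 - 2 * t * Re (\<omega> * cinner (S u) u) + t\<^sup>2 * (norm (S u))\<^sup>2"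
      unfolding \<Phi>u norm_diff_cinner by (simp add: cinner_scaleR_right power_mult_distrib \<omega>)
    also have "\<dots> \<le> (norm u)\<^sup>2 - 2 * t * (\<kappa> * (norm u)\<^sup>2) + t\<^sup>2 * (N * norm u)\<^sup>2"
      using coercive[of u] boundN[of u] \<kappa> N
      by (intro add_mono diff_mono mult_left_mono power_mono) (auto simp: t_def)
    also have "\<dots> = (c * norm u)\<^sup>2"
      using N unfolding power_mult_distrib c t_def by (simp add: power2_eq_square field_simps)
    finally have "norm (\<Phi> x - \<Phi> x') \<le> c * norm u"
      by (rule power2_le_imp_le) (simp add: c)
    then show ?thesis by (simp add: dist_norm u_def)
  qed
  then obtain x where "\<Phi> x = x" using banach_fix_type[of c \<Phi>] c by blast
  then have "t *\<^sub>R scaleC \<omega> (S x - y) = 0" by (simp add: \<Phi>_def)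
  moreover have "t \<noteq> 0" "\<omega> \<noteq> 0" using \<kappa> N \<omega> by (auto simp: t_def)
  ultimately have "S x = y" by (simp add: cvs.scale_eq_0_iff)
  then show ?thesis by (rule that)
qed

subsection \<open>Positive square roots\<close>

text \<open>Coefficients of the binomial series of \<open>sqrt (1 - x)\<close>.\<close>

definition sqrt_coeff :: "nat \<Rightarrow> real" where
  "sqrt_coeff n = (1/2 gchoose n) * (- 1) ^ n"

lemma sqrt_coeff_0 [simp]: "sqrt_coeff 0 = 1"
  by (simp add: sqrt_coeff_def)

text \<open>Partial sums are the coefficients of the series divided by 1 - x, hence those of (1 -
  x)^(-1/2), which are positive.\<close>

lemma sum_sqrt_coeff: "(\<Sum>k\<le>n. sqrt_coeff k) = (- 1) ^ n * (- (1/2) gchoose n)"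
  using gbinomial_sum_lower_neg[of "1/2::real" n] by (simp add: sqrt_coeff_def)

lemma sum_sqrt_coeff_Suc:
  "(\<Sum>k\<le>Suc n. sqrt_coeff k) = (real n + 1/2) / (real n + 1) * (\<Sum>k\<le>n. sqrt_coeff k)"
proof -
  define g where "g k = (- (1/2) gchoose k :: real)" for k
  have "- (1/2) * g n = real n * g n + real (Suc n) * g (Suc n)"
    unfolding g_def by (rule gbinomial_mult_1)
  then have "g (Suc n) = - ((real n + 1/2) / (real n + 1) * g n)"
    by (simp add: field_simps)
  then show ?thesis
    unfolding sum_sqrt_coeff g_def[symmetric] by simp
qed

lemma sum_sqrt_coeff_nonneg: "(\<Sum>k\<le>n. sqrt_coeff k) \<ge> 0"
proof (induction n)
  case (Suc n)
  then show ?case unfolding sum_sqrt_coeff_Suc by simp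
qed simp

lemma sqrt_coeff_Suc_nonpos: "sqrt_coeff (Suc n) \<le> 0"
proof -
  have "(real n + 1/2) / (real n + 1) * (\<Sum>k\<le>n. sqrt_coeff k) \<le> 1 * (\<Sum>k\<le>n. sqrt_coeff k)"
    by (intro mult_right_mono sum_sqrt_coeff_nonneg) (simp add: field_simps)
  then have "(\<Sum>k\<le>Suc n. sqrt_coeff k) \<le> (\<Sum>k\<le>n. sqrt_coeff k)"
    unfolding sum_sqrt_coeff_Suc by simp
  then show ?thesis by simp
qed

text \<open>Only the coefficient of index 0 is positive, so the absolute partial sums are 2 minus
  the signed ones, and the latter are nonnegative.\<close>

lemma summable_abs_sqrt_coeff: "summable (\<lambda>n. \<bar>sqrt_coeff n\<bar>)"
proof (rule bounded_imp_summable)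
  have "(\<Sum>k\<le>n. \<bar>sqrt_coeff k\<bar>) = 2 - (\<Sum>k\<le>n. sqrt_coeff k)" for n
    by (induction n) (simp_all add: abs_of_nonpos sqrt_coeff_Suc_nonpos)
  then show "(\<Sum>k\<le>n. \<bar>sqrt_coeff k\<bar>) \<le> 2" for n
    using sum_sqrt_coeff_nonneg[of n] by simp
qed simp

text \<open>The square of the series is 1 - x: Vandermonde's identity with 1/2 + 1/2 = 1.\<close>

lemma sqrt_coeff_convolution:
  "(\<Sum>i\<le>n. sqrt_coeff i * sqrt_coeff (n - i)) = (if n = 0 then 1 else if n = 1 then - 1 else 0)"
proof -
  have "(\<Sum>i\<le>n. sqrt_coeff i * sqrt_coeff (n - i))
      = (- 1) ^ n * (\<Sum>i\<in>{0..n}. (1/2 gchoose i) * (1/2 gchoose (n - i)))"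
    unfolding sum_distrib_left atLeast0AtMost
    by (intro sum.cong refl) (simp add: sqrt_coeff_def power_add[symmetric] mult_ac)
  also have "\<dots> = (- 1) ^ n * (1 gchoose n)"
    unfolding gbinomial_Vandermonde by simp
  also have "(1 gchoose n :: real) = of_nat (1 choose n)"
    using binomial_gbinomial[of 1 n, where 'a = real] by simp
  finally show ?thesis by (cases n) (auto simp: binomial_eq_0)
qed

text \<open>All later coefficients being nonpositive, replacing each \<open>u k\<close> by
  \<open>u 0\<close> can only lower a partial sum, and what remains is a nonnegative partial sum of
  coefficients times \<open>u 0\<close>. It is meant for \<open>u n\<close> = Re
  \<open>cinner ((C ^^ n) x) x\<close>.\<close>

lemma sums_sqrt_coeff_nonneg:
  assumes "\<And>n. \<bar>u n\<bar> \<le> u 0" and "(\<lambda>n. sqrt_coeff n * u n) sums l"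
  shows "0 \<le> l"
proof (rule LIMSEQ_le_const)
  show "(\<lambda>n. \<Sum>k\<le>n. sqrt_coeff k * u k) \<longlonglongrightarrow> l"
    using assms(2) by (simp add: sums_def_le)
  have "sqrt_coeff k * u 0 \<le> sqrt_coeff k * u k" for k
    using assms(1)[of k] sqrt_coeff_Suc_nonpos
    by (cases k) (auto intro: mult_left_mono_neg)
  then have "(\<Sum>k\<le>n. sqrt_coeff k) * u 0 \<le> (\<Sum>k\<le>n. sqrt_coeff k * u k)" for n
    unfolding sum_distrib_right by (intro sum_mono)
  moreover have "0 \<le> (\<Sum>k\<le>n. sqrt_coeff k) * u 0" for n
    using sum_sqrt_coeff_nonneg[of n] assms(1)[of 0] by (intro mult_nonneg_nonneg) auto
  ultimately show "\<exists>N. \<forall>n\<ge>N. 0 \<le> (\<Sum>k\<le>n. sqrt_coeff k * u k)"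
    using order.trans by blast
qed

text \<open>A Cauchy product whose weight depends only on n + m, as powers of an operator do.
  Boundedness of \<open>u\<close> makes the double family absolutely summable, so it may be summed
  by rows or along the antidiagonals n + m = k.\<close>

lemma sums_convolution_weighted:
  fixes a b u :: "nat \<Rightarrow> complex"
  assumes a: "summable (\<lambda>n. cmod (a n))" and b: "summable (\<lambda>n. cmod (b n))"
    and u: "\<And>n. cmod (u n) \<le> M"
    and inner: "\<And>n. (\<lambda>m. b m * u (n + m)) sums s n"
    and outer: "(\<lambda>n. a n * s n) sums l"
    and conv: "(\<lambda>k. (\<Sum>i\<le>k. a i * b (k - i)) * u k) sums l'"
  shows "l = l'"
proof -
  have bound: "cmod (b m * u (n + m)) \<le> cmod (b m) * M" for n m
    by (simp add: norm_mult u mult_left_mono)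
  define f where "f = (\<lambda>(n, m). a n * (b m * u (n + m)))"
  have "(\<lambda>(n, m). cmod (a n) * (cmod (b m) * M)) summable_on (UNIV \<times> UNIV)"
  proof (rule summable_on_SigmaI)
    have "(\<lambda>m. cmod (b m)) sums (\<Sum>m. cmod (b m))" using b by (rule summable_sums)
    then have "((\<lambda>m. cmod (b m)) has_sum (\<Sum>m. cmod (b m))) UNIV"
      by (rule sums_nonneg_imp_has_sum) simp
    then show "((\<lambda>m. case (n, m) of (n, m) \<Rightarrow> cmod (a n) * (cmod (b m) * M))
        has_sum cmod (a n) * ((\<Sum>m. cmod (b m)) * M)) UNIV" for n
      by (simp add: has_sum_cmult_left has_sum_cmult_right)
    have "(\<lambda>n. cmod (a n)) summable_on UNIV"
      using a by (simp add: summable_nonneg_imp_summable_on)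
    then show "(\<lambda>n. cmod (a n) * ((\<Sum>m. cmod (b m)) * M)) summable_on UNIV"
      by (rule summable_on_cmult_left)
    have "0 \<le> M" using u[of 0] norm_ge_zero order.trans by blast
    then show "0 \<le> (case (n, m) of (n, m) \<Rightarrow> cmod (a n) * (cmod (b m) * M))" for n m
      by simp
  qed
  then have "(\<lambda>p. cmod (f p)) summable_on (UNIV \<times> UNIV)"
    by (rule Infinite_Sum.abs_summable_on_comparison_test')
      (auto simp: f_def norm_mult u intro!: mult_left_mono)
  then have "f summable_on (UNIV \<times> UNIV)" by (rule abs_summable_summable)
  then obtain L where L: "(f has_sum L) (UNIV \<times> UNIV)" by (auto simp: summable_on_def)
  have "((\<lambda>n. a n * s n) has_sum L) UNIV"
  proof (rule has_sum_SigmaD[OF L])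
    fix n
    have "summable (\<lambda>m. cmod (b m * u (n + m)))"
      by (rule summable_comparison_test'[OF summable_mult2[OF b, of M]]) (use bound in auto)
    then have "((\<lambda>m. b m * u (n + m)) has_sum s n) UNIV"
      using inner by (rule norm_summable_imp_has_sum)
    then show "((\<lambda>m. f (n, m)) has_sum a n * s n) UNIV"
      unfolding f_def by (simp add: has_sum_cmult_right)
  qed
  then have "l = L" using outer has_sum_imp_sums sums_unique2 by blast
  have "((\<lambda>p. f (snd p, fst p - snd p)) has_sum L) (SIGMA k:UNIV. {..k}) \<longleftrightarrow> (f has_sum L) (UNIV \<times> UNIV)"
    by (rule has_sum_reindex_bij_witness[where i = "\<lambda>(i, j). (i + j, i)"
          and j = "\<lambda>(k, i). (i, k - i)"]) auto
  then have "((\<lambda>p. f (snd p, fst p - snd p)) has_sum L) (SIGMA k:UNIV. {..k})" using L by simp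
  then have "((\<lambda>k. (\<Sum>i\<le>k. a i * b (k - i)) * u k) has_sum L) UNIV"
  proof (rule has_sum_SigmaD)
    show "((\<lambda>i. f (snd (k, i), fst (k, i) - snd (k, i))) has_sum
        (\<Sum>i\<le>k. a i * b (k - i)) * u k) {..k}" for k
      by (rule has_sum_finiteI) (auto simp: f_def sum_distrib_right mult.assoc intro!: sum.cong)
  qed
  then have "l' = L" using conv has_sum_imp_sums sums_unique2 by blast
  with \<open>l = L\<close> show ?thesis by simp
qed

text \<open>Polarisation: a real quadratic form at x + y relates the imaginary parts of the two
  cross terms, and at x + \<i> y the real parts.\<close>

lemma positive_op_adjoint_pair:
  assumes "positive_op Q"
  shows "adjoint_pair Q Q"
  unfolding adjoint_pair_def
proof (intro allI)
  fix x y
  have add: "Q (v + w) = Q v + Q w" and scale: "Q (scaleC c v) = scaleC c (Q v)"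
    and real: "Im (cinner (Q v) v) = 0" for c v w
    using assms by (auto simp: positive_op_def clinear_op_def)
  have "Im (cinner (Q x) y) = - Im (cinner (Q y) x)"
    using real[of "x + y"] by (simp add: add cinner_simps real)
  moreover have "Re (cinner (Q x) y) = Re (cinner (Q y) x)"
    using real[of "x + scaleC \<i> y"] by (simp add: add scale cinner_simps real)
  ultimately have "cinner (Q x) y = cnj (cinner (Q y) x)" by (simp add: complex_eq_iff)
  then show "cinner (Q x) y = cinner x (Q y)" by (metis cinner_commute)
qed

text \<open>Along y + t Q y the form is a nonnegative polynomial in t without constant term, whose
  linear coefficient is twice the squared norm of Q y.\<close>

lemma positive_op_eq_0:
  assumes Q: "positive_op Q" and y: "cinner (Q y) y = 0"
  shows "Q y = 0"
proof -
  have sa: "adjoint_pair Q Q" by (rule positive_op_adjoint_pair[OF Q])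
  define z where "z = Q y"
  have "0 \<le> 2 * t * (norm z)\<^sup>2 + t\<^sup>2 * Re (cinner (Q z) z)" for t
  proof -
    have "0 \<le> Re (cinner (Q (y + t *\<^sub>R z)) (y + t *\<^sub>R z))"
      using Q by (simp add: positive_op_def)
    also have "\<dots> = t * Re (cinner (Q y) z) + t * Re (cinner (Q z) y) + t\<^sup>2 * Re (cinner (Q z) z)"
      by (simp add: adjoint_pair_linear[OF sa] scaleR_scaleC cinner_simps y power2_eq_square algebra_simps)
    also have "cinner (Q z) y = cinner z z"
      by (simp add: adjoint_pairD[OF sa] z_def)
    finally show ?thesis by (simp add: z_def[symmetric] cinner_self)
  qed
  then have "(norm z)\<^sup>2 = 0" by (rule linear_coeff_zero)
  then show ?thesis by (simp add: z_def)
qed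

lemma adjoint_pair_funpow: "adjoint_pair C C \<Longrightarrow> adjoint_pair (C ^^ n) (C ^^ n)"
proof (induction n)
  case (Suc n)
  then show ?case by (simp add: adjoint_pair_def funpow_swap1 del: funpow.simps(2) add: funpow_Suc_right)
qed (simp add: adjoint_pair_def)

lemma norm_funpow_le:
  fixes C :: "'a::real_normed_vector \<Rightarrow> 'a"
  assumes "\<And>x. norm (C x) \<le> norm x"
  shows "norm ((C ^^ n) x) \<le> norm x"
proof (induction n)
  case (Suc n)
  then show ?case using assms[of "(C ^^ n) x"] by simp
qed simp

text \<open>The binomial series of \<open>sqrt (1 - C)\<close> is taken in the weak sense: the sort
  complex_inner, complete_space does not entail banach, so the library results on series are
  only available for the scalars.\<close>

definition sqrt_series :: "('a::complex_inner \<Rightarrow> 'a) \<Rightarrow> ('a \<Rightarrow> 'a) \<Rightarrow> bool" where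
  "sqrt_series C S \<longleftrightarrow>
     (\<forall>x y. (\<lambda>n. of_real (sqrt_coeff n) * cinner ((C ^^ n) x) y) sums cinner (S x) y)"

lemma sqrt_series_exists:
  fixes C :: "'a::{complex_inner, complete_space} \<Rightarrow> 'a"
  assumes contr: "\<And>x. norm (C x) \<le> norm x"
  obtains S where "sqrt_series C S"
proof -
  define A where "A = (\<Sum>n. \<bar>sqrt_coeff n\<bar>)"
  let ?t = "\<lambda>x y n. of_real (sqrt_coeff n) * cinner ((C ^^ n) x) y"
  have bound: "cmod (?t x y n) \<le> \<bar>sqrt_coeff n\<bar> * (norm x * norm y)" for x y n
    unfolding norm_mult norm_of_real
    by (intro mult_left_mono order.trans[OF cmod_cinner_le] mult_right_mono norm_funpow_le contr) auto
  have dom: "summable (\<lambda>n. \<bar>sqrt_coeff n\<bar> * (norm x * norm y))" for x y :: 'a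
    by (rule summable_mult2[OF summable_abs_sqrt_coeff])
  have sm: "summable (?t x y)" for x y
    by (rule summable_comparison_test'[OF dom[of x y]]) (rule bound)
  obtain S where S: "\<And>x y. (\<Sum>n. ?t x y n) = cinner (S x) y"
  proof (rule form_representation[of "\<lambda>x y. \<Sum>n. ?t x y n" "\<lambda>x. A * norm x"])
    show "(\<Sum>n. ?t x (y + z) n) = (\<Sum>n. ?t x y n) + (\<Sum>n. ?t x z n)" for x y z
      by (simp add: cinner_add_right distrib_left suminf_add[OF sm sm])
    show "(\<Sum>n. ?t x (scaleC c y) n) = cnj c * (\<Sum>n. ?t x y n)" for c x y
      unfolding suminf_mult[OF sm, symmetric] by (simp add: cinner_scaleC_right mult_ac)
    show "cmod (\<Sum>n. ?t x y n) \<le> A * norm x * norm y" for x y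
    proof -
      have "cmod (\<Sum>n. ?t x y n) \<le> (\<Sum>n. \<bar>sqrt_coeff n\<bar> * (norm x * norm y))"
        by (rule norm_suminf_le[OF bound dom])
      also have "\<dots> = A * (norm x * norm y)"
        unfolding A_def by (rule suminf_mult2[OF summable_abs_sqrt_coeff, symmetric])
      finally show ?thesis by (simp add: mult.assoc)
    qed
  qed (rule that)
  then have "sqrt_series C S"
    unfolding sqrt_series_def using summable_sums[OF sm] by simp
  then show ?thesis by (rule that)
qed

text \<open>The relation passes to all powers, and moving \<open>A\<close> to the other side of the
  inner product makes the two weak series equal term by term. With \<open>A\<close> = T it relates
  the two defect operators; with \<open>A\<close> a competing square root it gives the commutation
  behind uniqueness.\<close>

lemma sqrt_series_intertwine:
  assumes "sqrt_series C S" and "sqrt_series C' S'" and A: "adjoint_pair A A'"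
    and comm: "\<And>x. A (C x) = C' (A x)"
  shows "A (S x) = S' (A x)"
proof (rule cinner_eqI)
  fix y
  have "A ((C ^^ n) x) = (C' ^^ n) (A x)" for n
    by (induction n) (simp_all add: comm)
  then have eq: "cinner ((C ^^ n) x) (A' y) = cinner ((C' ^^ n) (A x)) y" for n
    by (simp add: adjoint_pairD[OF A, symmetric])
  have "(\<lambda>n. of_real (sqrt_coeff n) * cinner ((C ^^ n) x) (A' y)) sums cinner (S x) (A' y)"
    using assms(1) unfolding sqrt_series_def by blast
  then have "(\<lambda>n. of_real (sqrt_coeff n) * cinner ((C' ^^ n) (A x)) y) sums cinner (S x) (A' y)"
    by (simp only: eq)
  moreover have "(\<lambda>n. of_real (sqrt_coeff n) * cinner ((C' ^^ n) (A x)) y) sums cinner (S' (A x)) y"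
    using assms(2) unfolding sqrt_series_def by blast
  ultimately have "cinner (S x) (A' y) = cinner (S' (A x)) y"
    by (rule sums_unique2)
  then show "cinner (A (S x)) y = cinner (S' (A x)) y"
    by (simp add: adjoint_pairD[OF A])
qed

lemma sqrt_series_adjoint_pair:
  assumes S: "sqrt_series C S" and C: "adjoint_pair C C"
  shows "adjoint_pair S S"
  unfolding adjoint_pair_def
proof (intro allI)
  fix x y
  have "(\<lambda>n. cnj (of_real (sqrt_coeff n) * cinner ((C ^^ n) y) x)) sums cnj (cinner (S y) x)"
    using S unfolding sqrt_series_def sums_cnj by blast
  moreover have "cnj (of_real (sqrt_coeff n) * cinner ((C ^^ n) y) x)
      = of_real (sqrt_coeff n) * cinner ((C ^^ n) x) y" for n
    using adjoint_pairD[OF adjoint_pair_funpow[OF C], of n x y] cinner_commute[of x "(C ^^ n) y"]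
    by simp
  ultimately have "(\<lambda>n. of_real (sqrt_coeff n) * cinner ((C ^^ n) x) y) sums cnj (cinner (S y) x)"
    by (simp only:)
  moreover have "(\<lambda>n. of_real (sqrt_coeff n) * cinner ((C ^^ n) x) y) sums cinner (S x) y"
    using S unfolding sqrt_series_def by blast
  ultimately have "cnj (cinner (S y) x) = cinner (S x) y"
    by (rule sums_unique2)
  then show "cinner (S x) y = cinner x (S y)" by (metis cinner_commute)
qed

lemma sqrt_series_positive:
  assumes S: "sqrt_series C S" and C: "adjoint_pair C C" and contr: "\<And>x. norm (C x) \<le> norm x"
  shows "positive_op S"
  unfolding positive_op_def
proof (intro conjI allI)
  have sa: "adjoint_pair S S" by (rule sqrt_series_adjoint_pair[OF S C])
  then show "clinear_op S" by (rule adjoint_pair_clinear)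
  fix x
  have "cinner (S x) x = cnj (cinner (S x) x)"
    using sa by (metis adjoint_pairD cinner_commute)
  then show "Im (cinner (S x) x) = 0" by (simp add: complex_eq_iff)
  show "0 \<le> Re (cinner (S x) x)"
  proof (rule sums_sqrt_coeff_nonneg)
    have "(\<lambda>n. Re (of_real (sqrt_coeff n) * cinner ((C ^^ n) x) x)) sums Re (cinner (S x) x)"
      using S unfolding sqrt_series_def by (intro sums_Re) blast
    then show "(\<lambda>n. sqrt_coeff n * Re (cinner ((C ^^ n) x) x)) sums Re (cinner (S x) x)" by simp
    have "cmod (cinner ((C ^^ n) x) x) \<le> norm x * norm x" for n
      by (intro order.trans[OF cmod_cinner_le] mult_right_mono norm_funpow_le contr) auto
    then show "\<bar>Re (cinner ((C ^^ n) x) x)\<bar> \<le> Re (cinner ((C ^^ 0) x) x)" for n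
      using abs_Re_le_cmod[of "cinner ((C ^^ n) x) x"] order.trans
      by (fastforce simp: cinner_self power2_eq_square)
  qed
qed

lemma sqrt_series_square:
  assumes S: "sqrt_series C S" and C: "adjoint_pair C C" and contr: "\<And>x. norm (C x) \<le> norm x"
  shows "S (S x) = x - C x"
proof (rule cinner_eqI)
  fix y
  have sa: "adjoint_pair S S" by (rule sqrt_series_adjoint_pair[OF S C])
  define a where "a n = complex_of_real (sqrt_coeff n)" for n
  define u where "u n = cinner ((C ^^ n) x) y" for n
  have Sd: "(\<lambda>n. a n * cinner ((C ^^ n) v) w) sums cinner (S v) w" for v w
    using S unfolding sqrt_series_def a_def by blast
  have conv: "(\<Sum>i\<le>n. a i * a (n - i)) = (if n = 0 then 1 else if n = 1 then - 1 else 0)" for n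
    using arg_cong[OF sqrt_coeff_convolution[of n], of complex_of_real]
    by (simp add: a_def split: if_splits)
  have "cinner (S (S x)) y = u 0 - u 1"
  proof (rule sums_convolution_weighted)
    show "summable (\<lambda>n. cmod (a n))" "summable (\<lambda>n. cmod (a n))"
      using summable_abs_sqrt_coeff by (simp_all add: a_def)
    show "cmod (u n) \<le> norm x * norm y" for n
      unfolding u_def
      by (intro order.trans[OF cmod_cinner_le] mult_right_mono norm_funpow_le contr) auto
    show "(\<lambda>m. a m * u (n + m)) sums cinner (S ((C ^^ n) x)) y" for n
      using Sd[of "(C ^^ n) x" y]
      by (simp add: u_def funpow_add[of _ n, unfolded o_def] add.commute[of n] funpow_add)
    have "(\<lambda>n. a n * cinner ((C ^^ n) x) (S y)) sums cinner (S x) (S y)" by (rule Sd)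
    then show "(\<lambda>n. a n * cinner (S ((C ^^ n) x)) y) sums cinner (S (S x)) y"
      by (simp add: adjoint_pairD[OF sa])
    have "(\<lambda>k. (\<Sum>i\<le>k. a i * a (k - i)) * u k) sums (\<Sum>k\<in>{0, 1}. (\<Sum>i\<le>k. a i * a (k - i)) * u k)"
      unfolding conv by (rule sums_finite) auto
    then show "(\<lambda>k. (\<Sum>i\<le>k. a i * a (k - i)) * u k) sums (u 0 - u 1)"
      unfolding conv by simp
  qed
  then show "cinner (S (S x)) y = cinner (x - C x) y"
    by (simp add: u_def cinner_diff_left)
qed

text \<open>Uniqueness of the positive root \<open>Q\<close>: it commutes with C = 1 - Q^2, hence
  with S, so (Q + S)(Q - S) = 0. For y = Q x - S x the nonnegative numbers <Q y, y> and <S y, y> add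
  up to 0, so Q y = S y = 0, and the squared norm of y equals <x, (Q - S) y> = 0.\<close>

lemma op_sqrt_eq_series:
  assumes S: "sqrt_series C S" and C: "adjoint_pair C C" and contr: "\<And>x. norm (C x) \<le> norm x"
  shows "op_sqrt (\<lambda>x. x - C x) = S"
  unfolding op_sqrt_def
proof (rule the_equality)
  show "positive_op S \<and> (\<forall>x. S (S x) = x - C x)"
    using sqrt_series_positive[OF assms] sqrt_series_square[OF assms] by blast
  fix Q assume "positive_op Q \<and> (\<forall>x. Q (Q x) = x - C x)"
  then have Q: "positive_op Q" and QQ: "\<And>x. Q (Q x) = x - C x" by auto
  have saS: "adjoint_pair S S" and saQ: "adjoint_pair Q Q"
    using sqrt_series_adjoint_pair[OF S C] positive_op_adjoint_pair[OF Q] .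
  have "C x = x - Q (Q x)" for x by (simp add: QQ)
  then have "Q (C x) = C (Q x)" for x by (simp add: adjoint_pair_diff[OF saQ])
  then have comm: "Q (S x) = S (Q x)" for x
    by (rule sqrt_series_intertwine[OF S S saQ])
  show "Q = S"
  proof
    fix x
    define y where "y = Q x - S x"
    have "Q y + S y = 0"
      by (simp add: y_def adjoint_pair_diff[OF saQ] adjoint_pair_diff[OF saS] comm QQ
          sqrt_series_square[OF assms])
    then have "cinner (Q y) y + cinner (S y) y = 0"
      by (metis cinner_add_left cinner_zero_left)
    moreover have pos: "Re (cinner (Q y) y) \<ge> 0" "Im (cinner (Q y) y) = 0"
      "Re (cinner (S y) y) \<ge> 0" "Im (cinner (S y) y) = 0"
      using Q sqrt_series_positive[OF assms] by (auto simp: positive_op_def)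
    ultimately have "cinner (Q y) y = 0" "cinner (S y) y = 0"
      by (auto simp: complex_eq_iff)
    then have "Q y = 0" "S y = 0"
      using positive_op_eq_0 Q sqrt_series_positive[OF assms] by blast+
    then have "cinner y y = 0"
      by (metis y_def adjoint_pairD cinner_diff_left cinner_zero_right diff_self saQ saS)
    then show "Q x = S x" by (simp add: cinner_self y_def)
  qed
qed

subsection \<open>Orthonormal families\<close>

lemma gram_schmidt:
  fixes B :: "'a::complex_inner set"
  assumes "finite B" and "cvs.independent B"
  shows "\<exists>E. finite E \<and> card E = card B \<and> (\<forall>e\<in>E. \<forall>f\<in>E. cinner e f = of_bool (e = f))
      \<and> E \<subseteq> cvs.span B \<and> (\<forall>w\<in>cvs.span B. (\<Sum>e\<in>E. scaleC (cinner w e) e) = w)"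
  using assms
proof (induction B)
  case empty
  then show ?case by (auto intro!: exI[of _ "{}"])
next
  case (insert b B)
  have indep: "cvs.independent B" and b: "b \<notin> cvs.span B"
    using insert.prems insert.hyps by (auto simp: cvs.independent_insert)
  obtain E where fin: "finite E" and card: "card E = card B"
    and ortho: "\<And>e f. e \<in> E \<Longrightarrow> f \<in> E \<Longrightarrow> cinner e f = of_bool (e = f)"
    and sub: "E \<subseteq> cvs.span B"
    and expand: "\<And>w. w \<in> cvs.span B \<Longrightarrow> (\<Sum>e\<in>E. scaleC (cinner w e) e) = w"
    using insert.IH[OF indep] by blast
  define P where "P w = (\<Sum>e\<in>E. scaleC (cinner w e) e)" for w
  define b' where "b' = b - P b"
  have "P b \<in> cvs.span B"
    unfolding P_def using sub by (intro cvs.span_sum cvs.span_scale) auto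
  then have b'0: "b' \<noteq> 0" and b'span: "b' \<in> cvs.span (insert b B)"
    using b cvs.span_mono[of B "insert b B"] cvs.span_base[of b "insert b B"] cvs.span_diff
    by (auto simp: b'_def)
  have b'E: "cinner b' e = 0" if "e \<in> E" for e
  proof -
    have "(\<Sum>f\<in>E. cinner b f * cinner f e) = (\<Sum>f\<in>E. if f = e then cinner b e else 0)"
      using that by (intro sum.cong) (auto simp: ortho)
    then show ?thesis
      using that fin by (simp add: b'_def P_def cinner_simps)
  qed
  define u where "u = scaleC (1 / of_real (norm b')) b'"
  have b'u: "b' = scaleC (of_real (norm b')) u" using b'0 by (simp add: u_def)
  have uu: "cinner u u = 1"
    using b'0 by (simp add: cinner_self u_def norm_divide)
  have uE: "cinner u e = 0" if "e \<in> E" for e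
    using b'E[OF that] by (simp add: u_def cinner_scaleC_left)
  then have Eu: "cinner e u = 0" if "e \<in> E" for e
    using that cinner_commute[of e u] by simp
  have "u \<notin> E" using uE uu by fastforce
  have uspan: "u \<in> cvs.span (insert b B)"
    unfolding u_def using b'span by (rule cvs.span_scale)
  have Pu: "cinner (P w) u = 0" for w
    by (simp add: P_def cinner_simps Eu)
  define Q where "Q w = scaleC (cinner w u) u + P w" for w
  \<comment> \<open>The expansion need only be checked on the generators, since the fixed points of
    the linear map \<open>Q\<close> form a subspace.\<close>
  have "insert b B \<subseteq> {w. Q w = w}"
  proof (clarsimp, intro conjI subsetI)
    have "cinner b u = cinner b' u" by (simp add: b'_def cinner_diff_left Pu)
    also have "\<dots> = of_real (norm b')" by (subst b'u) (simp add: cinner_scaleC_left uu)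
    finally show "Q b = b" using b'u by (simp add: Q_def) (simp add: b'_def)
    fix w assume "w \<in> B"
    then have "P w = w" by (simp add: P_def expand cvs.span_base)
    then show "w \<in> {w. Q w = w}" using Pu[of w] by (simp add: Q_def)
  qed
  moreover have "cvs.subspace {w. Q w = w}"
  proof (rule cvs.subspaceI)
    have "Q (v + w) = Q v + Q w" for v w
      by (simp add: Q_def P_def cinner_add_left cvs.scale_left_distrib sum.distrib)
    then show "v + w \<in> {w. Q w = w}" if "v \<in> {w. Q w = w}" "w \<in> {w. Q w = w}" for v w
      using that by simp
    have "Q (scaleC c w) = scaleC c (Q w)" for c w
      by (simp add: Q_def P_def cinner_scaleC_left cvs.scale_right_distrib cvs.scale_sum_right)
    then show "scaleC c w \<in> {w. Q w = w}" if "w \<in> {w. Q w = w}" for c w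
      using that by simp
  qed (simp add: Q_def P_def)
  ultimately have "cvs.span (insert b B) \<subseteq> {w. Q w = w}" by (rule cvs.span_minimal)
  moreover have "(\<Sum>e\<in>insert u E. scaleC (cinner w e) e) = Q w" for w
    using fin \<open>u \<notin> E\<close> by (simp add: Q_def P_def)
  moreover have "insert u E \<subseteq> cvs.span (insert b B)"
    using uspan sub cvs.span_mono[of B "insert b B"] by blast
  ultimately show ?case
    using fin card \<open>u \<notin> E\<close> insert.hyps ortho uE Eu uu
    by (intro exI[of _ "insert u E"]) auto
qed

lemma orthonormal_basis_exists:
  fixes D :: "'a::complex_inner set"
  assumes "cdim_eq D CARD('n::finite)"
  obtains e :: "'n::finite \<Rightarrow> 'a" where "\<And>i j. cinner (e i) (e j) = of_bool (i = j)" and "\<And>i. e i \<in> D"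
    and "\<And>w. w \<in> D \<Longrightarrow> (\<Sum>i\<in>UNIV. scaleC (cinner w (e i)) (e i)) = w"
proof -
  obtain B where B: "finite B" "card B = CARD('n)" "cvs.independent B" "cvs.span B = D"
    using assms unfolding cdim_eq_def by blast
  obtain E where E: "finite E" "card E = card B"
    "\<And>e f. e \<in> E \<Longrightarrow> f \<in> E \<Longrightarrow> cinner e f = of_bool (e = f)"
    "E \<subseteq> cvs.span B" "\<And>w. w \<in> cvs.span B \<Longrightarrow> (\<Sum>e\<in>E. scaleC (cinner w e) e) = w"
    using gram_schmidt[OF B(1,3)] by blast
  obtain e :: "'n \<Rightarrow> 'a" where e: "bij_betw e UNIV E"
    using finite_same_card_bij[of "UNIV :: 'n set" E] E B by auto
  have eE: "e i \<in> E" for i using e by (auto simp: bij_betw_def)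
  show ?thesis
  proof (rule that)
    show "cinner (e i) (e j) = of_bool (i = j)" for i j
      using E(3)[OF eE eE, of i j] e by (auto simp: bij_betw_def inj_eq)
    show "e i \<in> D" for i using eE E(4) B(4) by blast
    show "(\<Sum>i\<in>UNIV. scaleC (cinner w (e i)) (e i)) = w" if "w \<in> D" for w
      using E(5)[of w] that B(4) sum.reindex_bij_betw[OF e, of "\<lambda>e. scaleC (cinner w e) e"] by simp
  qed
qed

text \<open>For an orthonormal basis of a defect space this is an isometry of C^N onto that space;
  for the family \<open>l\<close> of the half-plane construction it is the L of the
  overview.\<close>

definition synthesis :: "('n \<Rightarrow> 'a) \<Rightarrow> complex ^ 'n \<Rightarrow> 'a::complex_inner" where
  "synthesis e v = (\<Sum>i\<in>UNIV. scaleC (v $ i) (e i))"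

definition analysis :: "('n \<Rightarrow> 'a) \<Rightarrow> 'a::complex_inner \<Rightarrow> complex ^ 'n" where
  "analysis e h = (\<chi> i. cinner h (e i))"

lemma adjoint_pair_synthesis: "adjoint_pair (synthesis e) (analysis e)"
  unfolding adjoint_pair_def synthesis_def analysis_def
  by (auto simp: cinner_simps cinner_vec_def cinner_complex_def cinner_commute[of "e _"]
      intro!: sum.cong)

lemma adjoint_pair_analysis: "adjoint_pair (analysis e) (synthesis e)"
  by (rule adjoint_pair_sym[OF adjoint_pair_synthesis])

lemma analysis_synthesis:
  assumes "\<And>i j. cinner (e i) (e j) = of_bool (i = j)"
  shows "analysis e (synthesis e v) = v"
  by (simp add: analysis_def synthesis_def cinner_simps assms vec_eq_iff of_bool_def
      if_distrib[of "\<lambda>x. _ * x"] cong: if_cong)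

subsection \<open>Defect operators\<close>

lemma contraction_adjoint_pair:
  fixes T :: "'a::{complex_inner, complete_space} \<Rightarrow> 'a"
  assumes "contraction T"
  shows "adjoint_pair T (adjoint T)"
proof -
  obtain K where "T (x + y) = T x + T y" "T (scaleC c x) = scaleC c (T x)" "norm (T x) \<le> K * norm x"
    for x y c
    using assms unfolding contraction_def bounded_op_def clinear_op_def by blast
  then obtain T' where T': "adjoint_pair T T'" by (rule adjoint_pair_exists)
  then show ?thesis using adjoint_eqI[OF T'] by simp
qed

text \<open>Identifies the root described by \<open>op_sqrt\<close> with the weak series, so that
  intertwining relations become available for defect operators.\<close>

lemma defect_operator:
  fixes T :: "'a::{complex_inner, complete_space} \<Rightarrow> 'a"
  assumes T: "adjoint_pair T T'" and contr: "\<And>x. norm (T x) \<le> norm x"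
  obtains D where "sqrt_series (\<lambda>x. T' (T x)) D" and "defect_space T = closure (range D)"
    and "adjoint_pair D D" and "\<And>x. D (D x) = x - T' (T x)"
proof -
  let ?C = "\<lambda>x. T' (T x)"
  have C: "adjoint_pair ?C ?C"
    using T adjoint_pair_sym[OF T] by (simp add: adjoint_pair_def)
  have contrC: "norm (?C x) \<le> norm x" for x
    using adjoint_pair_contraction[OF T contr] contr order.trans by blast
  obtain D where D: "sqrt_series ?C D" using sqrt_series_exists[of ?C] contrC by blast
  show ?thesis
  proof (rule that)
    show "sqrt_series ?C D" by (rule D)
    show "defect_space T = closure (range D)"
      unfolding defect_space_def adjoint_eqI[OF T] op_sqrt_eq_series[OF D C contrC] by (rule refl)
    show "adjoint_pair D D" by (rule sqrt_series_adjoint_pair[OF D C])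
    show "D (D x) = x - T' (T x)" for x by (rule sqrt_series_square[OF D C contrC])
  qed
qed

subsection \<open>Unitary dilations\<close>

lemma dilationsI:
  fixes U :: "'a::complex_inner \<times> (complex ^ 'n) \<Rightarrow> 'a \<times> (complex ^ 'n)"
  assumes "adjoint_pair U V" and "\<And>z. V (U z) = z" and "\<And>z. U (V z) = z"
    and "\<And>h. fst (U (h, 0)) = T h"
  shows "U \<in> dilations T"
  using assms unfolding dilations_def unitary_ds_def dsinner_eq_cinner adjoint_pair_def by auto

text \<open>The Julia matrix with rows (T, D') and (D, -T'), where \<open>e\<close> and
  \<open>f\<close> identify the defect spaces of T and T' with C^N. Exchanging the roles of T and T'
  gives the adjoint matrix, so one computation serves both inverse identities.\<close>

definition julia where
  "julia T T' D D' e f = (\<lambda>(h, v).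
     (T h + D' (synthesis f v), analysis e (D h) - analysis e (T' (synthesis f v))))"

lemma julia_inverse:
  assumes T: "adjoint_pair T T'" and D: "adjoint_pair D D" and D': "adjoint_pair D' D'"
    and DD: "\<And>x. D (D x) = x - T' (T x)" and DD': "\<And>x. D' (D' x) = x - T (T' x)"
    and comm: "\<And>x. T (D x) = D' (T x)" and comm': "\<And>x. T' (D' x) = D (T' x)"
    and eD: "\<And>x. synthesis e (analysis e (D x)) = D x"
    and eT: "\<And>v. synthesis e (analysis e (T' (synthesis f v))) = T' (synthesis f v)"
    and f: "\<And>v. analysis f (synthesis f v) = v"
  shows "julia T' T D' D f e (julia T T' D D' e f z) = z"
proof -
  obtain h v where z: "z = (h, v)" by (cases z)
  note lin = adjoint_pair_linear[OF T] adjoint_pair_linear[OF adjoint_pair_sym[OF T]]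
    adjoint_pair_linear[OF D] adjoint_pair_linear[OF D']
    adjoint_pair_linear[OF adjoint_pair_synthesis] adjoint_pair_linear[OF adjoint_pair_analysis]
  show ?thesis
    by (simp add: z julia_def lin eD eT DD DD' comm comm' f)
qed

lemma adjoint_pair_julia:
  assumes T: "adjoint_pair T T'" and D: "adjoint_pair D D" and D': "adjoint_pair D' D'"
  shows "adjoint_pair (julia T T' D D' e f) (julia T' T D' D f e)"
  by (auto simp: adjoint_pair_def julia_def cinner_prod_def cinner_simps adjoint_pairD[OF T]
      adjoint_pairD[OF adjoint_pair_sym[OF T]] adjoint_pairD[OF D] adjoint_pairD[OF D']
      adjoint_pairD[OF adjoint_pair_synthesis] adjoint_pairD[OF adjoint_pair_analysis])

text \<open>Intertwining sends the range of \<open>D\<close> into that of \<open>D'\<close>, and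
  continuity extends this to the closures, where the basis vectors of the defect spaces
  live.\<close>

lemma image_closure_defect:
  fixes T :: "'a::complex_inner \<Rightarrow> 'b::complex_inner"
  assumes T: "adjoint_pair T T'" and contr: "\<And>x. norm (T x) \<le> norm x"
    and comm: "\<And>x. T (D x) = D' (T x)" and "w \<in> closure (range D)"
  shows "T w \<in> closure (range D')"
proof -
  obtain x where x: "\<And>n. x n \<in> range D" "x \<longlonglongrightarrow> w"
    using assms(4) by (auto simp: closure_sequential)
  have "(\<lambda>n. T (x n)) \<longlonglongrightarrow> T w"
  proof (rule Lim_null[THEN iffD2], rule Lim_null_comparison)
    show "\<forall>\<^sub>F n in sequentially. norm (T (x n) - T w) \<le> norm (x n - w)"
      using contr by (simp add: adjoint_pair_diff[OF T, symmetric])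
    show "(\<lambda>n. norm (x n - w)) \<longlonglongrightarrow> 0" using x(2) by (simp add: LIM_zero tendsto_norm_zero)
  qed
  moreover have "T (x n) \<in> range D'" for n using x(1)[of n] comm by auto
  ultimately show ?thesis
    unfolding closure_sequential by (intro exI[of _ "\<lambda>n. T (x n)"]) simp
qed

text \<open>Equality of the two defect dimensions lets both defect spaces be identified with the
  same C^N.\<close>

lemma dilation_exists:
  fixes T :: "'a::{complex_inner, complete_space} \<Rightarrow> 'a"
  assumes "contraction T" and "cdim_eq (defect_space T) CARD('n::finite)"
    and "cdim_eq (defect_space (adjoint T)) CARD('n::finite)"
  obtains U :: "'a \<times> (complex ^ 'n::finite) \<Rightarrow> 'a \<times> (complex ^ 'n)" where "U \<in> dilations T"
proof -
  define T' where "T' = adjoint T"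
  have T: "adjoint_pair T T'" unfolding T'_def by (rule contraction_adjoint_pair[OF assms(1)])
  then have T': "adjoint_pair T' T" by (rule adjoint_pair_sym)
  have contr: "norm (T x) \<le> norm x" for x using assms(1) by (simp add: contraction_def)
  have contr': "norm (T' x) \<le> norm x" for x by (rule adjoint_pair_contraction[OF T contr])
  obtain D where D: "sqrt_series (\<lambda>x. T' (T x)) D" "defect_space T = closure (range D)"
    "adjoint_pair D D" "\<And>x. D (D x) = x - T' (T x)"
    using defect_operator[OF T contr] by blast
  obtain D' where D': "sqrt_series (\<lambda>x. T (T' x)) D'" "defect_space T' = closure (range D')"
    "adjoint_pair D' D'" "\<And>x. D' (D' x) = x - T (T' x)"
    using defect_operator[OF T' contr'] by blast
  have comm: "T (D x) = D' (T x)" for x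
    by (rule sqrt_series_intertwine[OF D(1) D'(1) T]) (rule refl)
  have comm': "T' (D' x) = D (T' x)" for x
    by (rule sqrt_series_intertwine[OF D'(1) D(1) T']) (rule refl)
  obtain e :: "'n \<Rightarrow> 'a" where e: "\<And>i j. cinner (e i) (e j) = of_bool (i = j)"
    "\<And>i. e i \<in> defect_space T"
    "\<And>w. w \<in> defect_space T \<Longrightarrow> (\<Sum>i\<in>UNIV. scaleC (cinner w (e i)) (e i)) = w"
    using orthonormal_basis_exists[OF assms(2)] by blast
  obtain f :: "'n \<Rightarrow> 'a" where f: "\<And>i j. cinner (f i) (f j) = of_bool (i = j)"
    "\<And>i. f i \<in> defect_space T'"
    "\<And>w. w \<in> defect_space T' \<Longrightarrow> (\<Sum>i\<in>UNIV. scaleC (cinner w (f i)) (f i)) = w"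
    using orthonormal_basis_exists[OF assms(3)] unfolding T'_def by blast
  have ee: "synthesis e (analysis e w) = w" if "w \<in> defect_space T" for w
    using e(3)[OF that] by (simp add: synthesis_def analysis_def)
  have ff: "synthesis f (analysis f w) = w" if "w \<in> defect_space T'" for w
    using f(3)[OF that] by (simp add: synthesis_def analysis_def)
  have TeF: "synthesis e (analysis e (T' (synthesis f v))) = T' (synthesis f v)" for v
  proof -
    have "T' (f i) \<in> defect_space T" for i
      unfolding D(2) using f(2) unfolding D'(2) by (rule image_closure_defect[where D = D' and D' = D, OF T' contr' comm'])
    then show ?thesis
      by (simp add: synthesis_def[of f] adjoint_pair_linear[OF T'] ee
          adjoint_pair_linear[OF adjoint_pair_synthesis] adjoint_pair_linear[OF adjoint_pair_analysis])
  qed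
  have TfE: "synthesis f (analysis f (T (synthesis e v))) = T (synthesis e v)" for v
  proof -
    have "T (e i) \<in> defect_space T'" for i
      unfolding D'(2) using e(2) unfolding D(2) by (rule image_closure_defect[where D = D and D' = D', OF T contr comm])
    then show ?thesis
      by (simp add: synthesis_def[of e] adjoint_pair_linear[OF T] ff
          adjoint_pair_linear[OF adjoint_pair_synthesis] adjoint_pair_linear[OF adjoint_pair_analysis])
  qed
  have De: "synthesis e (analysis e (D x)) = D x" for x
    by (rule ee) (simp add: D(2) closure_subset[THEN subsetD])
  have Df: "synthesis f (analysis f (D' x)) = D' x" for x
    by (rule ff) (simp add: D'(2) closure_subset[THEN subsetD])
  have "julia T T' D D' e f \<in> dilations T"
  proof (rule dilationsI)
    show "adjoint_pair (julia T T' D D' e f) (julia T' T D' D f e)"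
      by (rule adjoint_pair_julia[OF T D(3) D'(3)])
    show "julia T' T D' D f e (julia T T' D D' e f z) = z" for z
      by (rule julia_inverse[OF T D(3) D'(3) D(4) D'(4) comm comm' De TeF
            analysis_synthesis[OF f(1)]])
    show "julia T T' D D' e f (julia T' T D' D f e z) = z" for z
      by (rule julia_inverse[OF T' D'(3) D(3) D'(4) D(4) comm' comm Df TfE
            analysis_synthesis[OF e(1)]])
    show "fst (julia T T' D D' e f (h, 0)) = T h" for h
      by (simp add: julia_def adjoint_pair_zero[OF adjoint_pair_synthesis] adjoint_pair_zero[OF D'(3)])
  qed
  then show ?thesis by (rule that)
qed

section \<open>Dilations adapted to a half-plane\<close>

lemma Re_mult_of_real: "Re (w * of_real r) = Re w * r" "Re (of_real r * w) = r * Re w"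
  by simp_all

text \<open>The rotation of the overview is kept as the factor \<open>\<omega>\<close>, so
  \<open>\<omega> * \<mu>\<close> plays the part of m. The gap \<open>\<kappa>\<close> becomes the
  coercivity constant of \<open>S\<close>.\<close>

lemma half_plane_dilation:
  fixes T :: "'a::{complex_inner, complete_space} \<Rightarrow> 'a"
  assumes T: "contraction T" and dim: "cdim_eq (defect_space T) CARD('n::finite)"
    and \<omega>: "cmod \<omega> = 1" and \<mu>: "cmod \<mu> = 1" and \<kappa>: "\<kappa> > 0"
    and range: "\<And>x. Re (\<omega> * cinner (T x) x) \<le> (Re (\<omega> * \<mu>) - \<kappa>) * (norm x)\<^sup>2"
  obtains U :: "'a \<times> (complex ^ 'n::finite) \<Rightarrow> 'a \<times> (complex ^ 'n)"
  where "U \<in> dilations T" and "\<And>z. Re (\<omega> * cinner (U z) z) \<le> Re (\<omega> * \<mu>) * (norm z)\<^sup>2"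
proof -
  define T' where "T' = adjoint T"
  have T': "adjoint_pair T T'" unfolding T'_def by (rule contraction_adjoint_pair[OF T])
  note T'' = adjoint_pair_sym[OF T']
  have contr: "norm (T x) \<le> norm x" for x using T by (simp add: contraction_def)
  have contr': "norm (T' x) \<le> norm x" for x by (rule adjoint_pair_contraction[OF T' contr])
  have \<mu>\<mu>: "cnj \<mu> * \<mu> = 1" "\<mu> * cnj \<mu> = 1"
    using complex_norm_square[of \<mu>] \<mu> by (simp_all add: mult.commute)
  define S where "S x = scaleC \<mu> x - T x" for x
  define S' where "S' x = scaleC (cnj \<mu>) x - T' x" for x
  have SS': "adjoint_pair S S'"
    by (simp add: adjoint_pair_def S_def S'_def cinner_simps adjoint_pairD[OF T'])
  note S'S = adjoint_pair_sym[OF SS']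
  have boundS: "norm (S x) \<le> 2 * norm x" and boundS': "norm (S' x) \<le> 2 * norm x" for x
    unfolding S_def S'_def
    using norm_triangle_ineq4[of "scaleC \<mu> x" "T x"] norm_triangle_ineq4[of "scaleC (cnj \<mu>) x" "T' x"]
      contr[of x] contr'[of x] \<mu> by simp_all
  have coercive: "Re (\<omega> * cinner (S x) x) \<ge> \<kappa> * (norm x)\<^sup>2" for x
  proof -
    have "\<omega> * cinner (S x) x = (\<omega> * \<mu>) * of_real ((norm x)\<^sup>2) - \<omega> * cinner (T x) x"
      by (simp add: S_def cinner_simps cinner_self algebra_simps)
    then have "Re (\<omega> * cinner (S x) x) = Re (\<omega> * \<mu>) * (norm x)\<^sup>2 - Re (\<omega> * cinner (T x) x)"
      by (simp only: minus_complex.sel Re_mult_of_real)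
    then show ?thesis using range[of x] by (simp add: algebra_simps)
  qed
  have coercive': "Re (cnj \<omega> * cinner (S' x) x) \<ge> \<kappa> * (norm x)\<^sup>2" for x
  proof -
    have "cinner (S' x) x = cnj (cinner (S x) x)"
      by (metis adjoint_pairD[OF SS'] cinner_commute)
    then have "cnj \<omega> * cinner (S' x) x = cnj (\<omega> * cinner (S x) x)" by simp
    then show ?thesis using coercive[of x] by (simp only: complex_cnj)  simp
  qed
  have surjS: "\<exists>x. S x = y" for y
    using coercive_surj[OF adjoint_pair_diff[OF SS'] boundS coercive \<kappa> \<omega>] by metis
  have surjS': "\<exists>x. S' x = y" for y
    using coercive_surj[OF adjoint_pair_diff[OF S'S] boundS' coercive' \<kappa>] \<omega> complex_mod_cnj by metis
  have injS': "x = y" if "S' x = S' y" for x y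
  proof -
    have "S' (x - y) = 0" using that by (simp add: adjoint_pair_diff[OF S'S])
    then have "\<kappa> * (norm (x - y))\<^sup>2 \<le> 0" using coercive'[of "x - y"] by simp
    then show ?thesis using \<kappa> by (simp add: mult_le_0_iff)
  qed
  obtain D where "sqrt_series (\<lambda>x. T' (T x)) D" and D: "defect_space T = closure (range D)"
    "adjoint_pair D D" "\<And>x. D (D x) = x - T' (T x)"
    using defect_operator[OF T' contr] by blast
  obtain e :: "'n \<Rightarrow> 'a" where "\<And>i j. cinner (e i) (e j) = of_bool (i = j)"
    and "\<And>i. e i \<in> defect_space T" and e:
    "\<And>w. w \<in> defect_space T \<Longrightarrow> (\<Sum>i\<in>UNIV. scaleC (cinner w (e i)) (e i)) = w"
    using orthonormal_basis_exists[OF dim] by blast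
  \<comment> \<open>Applying D to the basis expansion of D x writes 1 - T' T as the sum of the
    rank-one operators given by the \<open>d i\<close>.\<close>
  define d where "d i = D (e i)" for i
  have defect: "(\<Sum>i\<in>UNIV. scaleC (cinner x (d i)) (d i)) = x - T' (T x)" for x
  proof -
    have "D x \<in> defect_space T" by (simp add: D(1) closure_subset[THEN subsetD])
    then have "D (\<Sum>i\<in>UNIV. scaleC (cinner (D x) (e i)) (e i)) = D (D x)" by (simp add: e)
    then show ?thesis
      by (simp add: adjoint_pair_linear[OF D(2)] D(3) d_def adjoint_pairD[OF D(2)])
  qed
  \<comment> \<open>The columns of L: since S' L has columns \<open>d i\<close>, the product S' L L*
    S is 1 - T' T.\<close>
  define l where "l i = (SOME x. S' x = d i)" for i
  have l: "S' (l i) = d i" for i unfolding l_def using surjS' by (rule someI_ex)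
  define J :: "'a \<times> (complex ^ 'n) \<Rightarrow> 'a" where "J z = fst z - synthesis l (snd z)" for z
  define J' where "J' g = (g, - analysis l g)" for g
  have JJ': "adjoint_pair J J'"
    by (simp add: adjoint_pair_def J_def J'_def cinner_simps cinner_prod_def
        adjoint_pairD[OF adjoint_pair_synthesis])
  note J'J = adjoint_pair_sym[OF JJ']
  \<comment> \<open>Expanding \<open>V (U z)\<close> leaves z plus J' applied to the difference of
    the two sides of this identity at \<open>J z\<close>.\<close>
  have key: "S' (J (J' (S x))) = scaleC (cnj \<mu>) (S x) + scaleC \<mu> (S' x)" for x
  proof -
    have "J (J' (S x)) = S x + (\<Sum>i\<in>UNIV. scaleC (cinner (S x) (l i)) (l i))"
      by (simp add: J_def J'_def synthesis_def analysis_def sum_negf)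
    then have "S' (J (J' (S x))) = S' (S x) + (x - T' (T x))"
      by (simp add: adjoint_pair_linear[OF S'S] adjoint_pairD[OF SS'] l defect)
    then show ?thesis
      by (simp add: S_def S'_def adjoint_pair_linear[OF T''] cvs.scale_right_diff_distrib
          \<mu>\<mu> algebra_simps)
  qed
  \<comment> \<open>An isometry of an infinite-dimensional space need not be onto, so U V = 1
    requires the identity with S and S' exchanged. It follows from \<open>key\<close> at w with S w
    = S' x, by cancelling the injective S'.\<close>
  have key': "S (J (J' (S' x))) = scaleC (cnj \<mu>) (S x) + scaleC \<mu> (S' x)" for x
  proof -
    obtain w where w: "S w = S' x" using surjS by blast
    have "S' (J (J' (S' x))) = S' (scaleC (cnj \<mu>) x + scaleC \<mu> w)"
      using key[of w] by (simp add: w adjoint_pair_linear[OF S'S])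
    then have "J (J' (S' x)) = scaleC (cnj \<mu>) x + scaleC \<mu> w" by (rule injS')
    then show ?thesis by (simp add: adjoint_pair_linear[OF SS'] w)
  qed
  define U where "U z = scaleC \<mu> z - J' (S (J z))" for z
  define V where "V z = scaleC (cnj \<mu>) z - J' (S' (J z))" for z
  note lin = adjoint_pair_linear[OF JJ'] adjoint_pair_linear[OF J'J]
    adjoint_pair_linear[OF SS'] adjoint_pair_linear[OF S'S]
  show ?thesis
  proof (rule that)
    show "U \<in> dilations T"
    proof (rule dilationsI)
      show "adjoint_pair U V"
        by (simp add: adjoint_pair_def U_def V_def cinner_simps adjoint_pairD[OF JJ']
            adjoint_pairD[OF J'J] adjoint_pairD[OF SS'])
      show "V (U z) = z" for z
        by (simp add: U_def V_def lin key cvs.scale_right_diff_distrib \<mu>\<mu>)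
      show "U (V z) = z" for z
        by (simp add: U_def V_def lin key' cvs.scale_right_diff_distrib \<mu>\<mu>)
      show "fst (U (h, 0)) = T h" for h
        by (simp add: U_def J_def J'_def S_def scaleC_prod_def adjoint_pair_zero[OF adjoint_pair_synthesis])
    qed
    show "Re (\<omega> * cinner (U z) z) \<le> Re (\<omega> * \<mu>) * (norm z)\<^sup>2" for z
    proof -
      have "\<omega> * cinner (U z) z = (\<omega> * \<mu>) * of_real ((norm z)\<^sup>2) - \<omega> * cinner (S (J z)) (J z)"
        by (simp add: U_def cinner_simps cinner_self adjoint_pairD[OF J'J] algebra_simps)
      then have "Re (\<omega> * cinner (U z) z) = Re (\<omega> * \<mu>) * (norm z)\<^sup>2 - Re (\<omega> * cinner (S (J z)) (J z))"
        by (simp only: minus_complex.sel Re_mult_of_real)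
      moreover have "0 \<le> \<kappa> * (norm (J z))\<^sup>2" using \<kappa> by simp
      ultimately show ?thesis using coercive[of "J z"] by linarith
    qed
  qed
qed

subsection \<open>Numerical ranges\<close>

lemma num_range_ds_eq: "num_range_ds U = {cinner (U x) x | x. norm x = 1}"
  by (simp add: num_range_ds_def dsinner_eq_cinner)

text \<open>The Toeplitz--Hausdorff theorem: on the segment between two unit vectors whose phases are
  adjusted so that the cross terms become real, the normalised quadratic form is a continuous
  real function from 0 to 1.\<close>

lemma convex_num_range:
  fixes T :: "'a::complex_inner \<Rightarrow> 'a"
  assumes "clinear_op T"
  shows "convex (num_range T)"
proof -
  have add: "T (x + y) = T x + T y" and scale: "T (scaleC c x) = scaleC c (T x)" for x y c
    using assms by (auto simp: clinear_op_def)
  have "(1 - s) *\<^sub>R p + s *\<^sub>R q \<in> num_range T"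
    if pq: "p \<in> num_range T" "q \<in> num_range T" and s: "0 \<le> s" "s \<le> 1" for p q s
  proof (cases "p = q")
    case True
    then show ?thesis using pq by (simp add: scaleR_left_distrib[symmetric])
  next
    case False
    obtain x y where x: "norm x = 1" "cinner (T x) x = p" and y: "norm y = 1" "cinner (T y) y = q"
      using pq by (auto simp: num_range_def)
    \<comment> \<open>An affine normalisation of the form, taking the value 0 at x and 1 at
      y.\<close>
    define h where "h u v = (cinner (T u) v - p * cinner u v) / (q - p)" for u v
    have hadd: "h (u + u') v = h u v + h u' v" "h v (u + u') = h v u + h v u'" for u u' v
      by (simp_all add: h_def add cinner_simps distrib_left add_divide_distrib diff_divide_distrib)
    have hscale: "h (scaleC c u) v = c * h u v" "h v (scaleC c u) = cnj c * h v u" for c u v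
      by (simp_all add: h_def scale cinner_simps right_diff_distrib mult_ac)
    have hx: "h x x = 0" and hy: "h y y = 1"
      using x y False by (simp_all add: h_def cinner_self)
    \<comment> \<open>The imaginary part of the cross term equals Im (\<mu> b), so
      \<open>\<mu>\<close> is the phase that makes \<mu> b real.\<close>
    define b where "b = h y x - cnj (h x y)"
    define \<mu> where "\<mu> = (if b = 0 then 1 else cnj b / of_real (cmod b))"
    have \<mu>: "cmod \<mu> = 1" by (simp add: \<mu>_def norm_divide)
    have "Im (\<mu> * b) = 0"
      using complex_norm_square[of b] by (simp add: \<mu>_def mult.commute)
    then have cross: "Im (cnj \<mu> * h x y + \<mu> * h y x) = 0"
      by (simp add: b_def algebra_simps)
    define r where "r = Re (cnj \<mu> * h x y + \<mu> * h y x)"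
    have r: "cnj \<mu> * h x y + \<mu> * h y x = of_real r"
      using cross by (simp add: r_def complex_eq_iff)
    define z where "z t = (1 - t) *\<^sub>R x + t *\<^sub>R scaleC \<mu> y" for t
    have \<mu>\<mu>: "\<mu> * cnj \<mu> = 1" using complex_norm_square[of \<mu>] \<mu> by simp
    have hz: "h (z t) (z t) = of_real (t\<^sup>2 + t * (1 - t) * r)" for t
    proof -
      have expand: "h (scaleC (of_real a) x + scaleC (of_real t) (scaleC \<mu> y))
            (scaleC (of_real a) x + scaleC (of_real t) (scaleC \<mu> y))
          = of_real (a\<^sup>2) * h x x + of_real (t\<^sup>2) * (\<mu> * cnj \<mu> * h y y)
            + of_real (t * a) * (cnj \<mu> * h x y + \<mu> * h y x)" for a :: real
        unfolding hadd hscale by (simp add: power2_eq_square algebra_simps)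
      have "h (z t) (z t) = of_real ((1 - t)\<^sup>2) * h x x + of_real (t\<^sup>2) * (\<mu> * cnj \<mu> * h y y)
          + of_real (t * (1 - t)) * (cnj \<mu> * h x y + \<mu> * h y x)"
        unfolding z_def scaleR_scaleC by (rule expand)
      then show ?thesis by (simp only: r hx hy \<mu>\<mu>) simp
    qed
    \<comment> \<open>If z t vanished, x and y would be related by (1 - t) x = - t \<mu> y;
      comparing the values of \<open>h\<close>, which are 0 and t^2, gives t = 0 and then x =
      0.\<close>
    have z0: "z t \<noteq> 0" for t
    proof
      assume "z t = 0"
      then have "scaleC (of_real (1 - t)) x = scaleC (- of_real t * \<mu>) y"
        by (simp add: z_def scaleR_scaleC eq_neg_iff_add_eq_0)
      then have "h (scaleC (of_real (1 - t)) x) (scaleC (of_real (1 - t)) x)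
          = h (scaleC (- of_real t * \<mu>) y) (scaleC (- of_real t * \<mu>) y)" by simp
      then have "of_real t * of_real t * (\<mu> * cnj \<mu>) = (0 :: complex)"
        by (simp only: hscale hx hy) (simp add: mult_ac)
      then have "t = 0" by (simp add: \<mu>\<mu>)
      with \<open>z t = 0\<close> show False using x by (simp add: z_def)
    qed
    define g where "g t = (t\<^sup>2 + t * (1 - t) * r) / (norm (z t))\<^sup>2" for t
    have cont: "continuous_on {0..1} g"
      unfolding g_def using z0 by (intro continuous_intros) (auto simp: z_def intro!: continuous_intros)
    have "g 0 = 0" "g 1 = 1"
      using y \<mu> by (simp_all add: g_def z_def)
    then obtain t where t: "g t = s"
      using IVT'[of g 0 s 1] s cont by auto
    define u where "u = scaleC (of_real (1 / norm (z t))) (z t)"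
    have nu: "norm u = 1" using z0[of t] by (simp add: u_def norm_divide)
    have "h u u = of_real (g t)"
      using z0[of t] by (simp only: u_def hscale hz) (simp add: g_def power2_eq_square)
    then have "cinner (T u) u - p = of_real s * (q - p)"
      using False nu t by (simp add: h_def cinner_self field_simps)
    then have "cinner (T u) u = (1 - s) *\<^sub>R p + s *\<^sub>R q"
      by (simp add: scaleR_conv_of_real algebra_simps)
    then show ?thesis using nu unfolding num_range_def by (metis (mono_tags, lifting) mem_Collect_eq)
  qed
  then show ?thesis by (simp add: convex_alt)
qed

text \<open>\<open>CARD('n)\<close> is positive, so an orthonormal family indexed by 'n provides a
  unit vector; \<open>undefined\<close> is just some index.\<close>

lemma num_range_nonempty:
  fixes T :: "'a::complex_inner \<Rightarrow> 'a"
  assumes "cdim_eq (D :: 'a set) CARD('n::finite)"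
  shows "num_range T \<noteq> {}"
proof -
  obtain e :: "'n \<Rightarrow> 'a" where e: "\<And>i j. cinner (e i) (e j) = of_bool (i = j)"
    and "\<And>i. e i \<in> D" and "\<And>w. w \<in> D \<Longrightarrow> (\<Sum>i\<in>UNIV. scaleC (cinner w (e i)) (e i)) = w"
    using orthonormal_basis_exists[OF assms] by blast
  have "complex_of_real ((norm (e undefined))\<^sup>2) = of_real 1"
    unfolding norm_cinner by (simp add: e)
  then have "(norm (e undefined))\<^sup>2 = 1\<^sup>2" by (simp only: of_real_eq_iff) simp
  then have "norm (e undefined) = 1" by (rule power2_eq_imp_eq) simp_all
  then show ?thesis by (auto simp: num_range_def)
qed

lemma num_range_subset_ds:
  assumes "U \<in> dilations T"
  shows "num_range T \<subseteq> num_range_ds U"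
proof
  fix w assume "w \<in> num_range T"
  then obtain x where x: "norm x = 1" "w = cinner (T x) x" by (auto simp: num_range_def)
  have "cinner (U (x, 0)) (x, 0) = w"
    using assms x by (simp add: cinner_prod_def dilations_def)
  then show "w \<in> num_range_ds U"
    unfolding num_range_ds_eq mem_Collect_eq using x(1)
    by (intro exI[of _ "(x, 0)"]) (simp add: norm_prod_def)
qed

section \<open>Continuity of the closed numerical range on the set of dilations\<close>

lemma dilations_adjoint:
  assumes "U \<in> dilations T"
  obtains V where "adjoint_pair U V" and "\<And>z. norm (U z) = norm z"
proof -
  obtain V where V: "adjoint_pair U V" "\<And>z. V (U z) = z"
    using assms unfolding dilations_def unitary_ds_def dsinner_eq_cinner adjoint_pair_def by blast
  have "complex_of_real ((norm (U z))\<^sup>2) = of_real ((norm z)\<^sup>2)" for z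
    unfolding norm_cinner by (simp add: adjoint_pairD[OF V(1)] V(2))
  then have "norm (U z) = norm z" for z
    by (simp only: of_real_eq_iff) (simp add: power2_eq_iff_nonneg)
  with V(1) show ?thesis by (rule that)
qed

lemma dilations_bounded_linear:
  assumes "U \<in> dilations T"
  shows "bounded_linear U"
proof -
  obtain V where V: "adjoint_pair U V" "\<And>z. norm (U z) = norm z"
    using dilations_adjoint[OF assms] by blast
  show ?thesis
    by (rule bounded_linear_intro[where K = 1])
      (simp_all add: adjoint_pair_linear[OF V(1)] scaleR_scaleC V(2))
qed

text \<open>The distance to a set is continuous, so bounds that hold on the sets persist on their
  closures.\<close>

lemma hausdorff_dist_closure_le:
  fixes A B :: "'a::metric_space set"
  assumes "A \<noteq> {}" and "B \<noteq> {}" and "\<And>a. a \<in> A \<Longrightarrow> infdist a B \<le> d"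
    and "\<And>b. b \<in> B \<Longrightarrow> infdist b A \<le> d"
  shows "hausdorff_dist (closure A) (closure B) \<le> d"
proof -
  have *: "infdist x (closure Y) \<le> d"
    if "Y \<noteq> {}" "\<And>a. a \<in> X \<Longrightarrow> infdist a Y \<le> d" "x \<in> closure X" for X Y :: "'a set" and x
  proof -
    have "closed {x. infdist x Y \<le> d}"
      by (intro closed_Collect_le continuous_intros)
    then have "closure X \<subseteq> {x. infdist x Y \<le> d}"
      using that(2) by (intro closure_minimal) auto
    moreover have "infdist x (closure Y) \<le> infdist x Y"
      using that(1) by (intro infdist_mono closure_subset)
    ultimately show ?thesis using that(3) by fastforce
  qed
  show ?thesis
    unfolding hausdorff_dist_def using assms
    by (intro max.boundedI cSUP_least *) auto
qed

text \<open>The points of the two numerical ranges that come from the same unit vector differ by at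
  most the norm of U - V; the map is Lipschitz with constant 1.\<close>

lemma hausdorff_dist_num_range_ds_le:
  fixes U V :: "'a::complex_inner \<times> (complex ^ 'n) \<Rightarrow> 'a \<times> (complex ^ 'n)"
  assumes "bounded_linear U" and "bounded_linear V"
  shows "hausdorff_dist (closure (num_range_ds U)) (closure (num_range_ds V)) \<le> onorm (\<lambda>x. U x - V x)"
proof -
  let ?d = "onorm (\<lambda>x. U x - V x)"
  have near: "dist (cinner (U x) x) (cinner (V x) x) \<le> ?d" if "norm x = 1" for x
  proof -
    have "norm (U x - V x) \<le> ?d"
      using onorm[OF bounded_linear_sub[OF assms], of x] that by simp
    then show ?thesis
      using cmod_cinner_le[of "U x - V x" x] that by (simp add: dist_norm cinner_diff_left)
  qed
  \<comment> \<open>A unit vector of the summand C^N witnesses that both numerical ranges are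
    nonempty.\<close>
  have "norm (axis undefined 1 :: complex ^ 'n) = 1"
    by (simp add: norm_vec_def L2_set_def axis_def if_distrib[of norm] if_distrib[of "\<lambda>x. x\<^sup>2"]
        cong: if_cong)
  then have "norm (0 :: 'a, axis undefined 1 :: complex ^ 'n) = 1"
    by (simp add: norm_prod_def)
  then have ne: "num_range_ds U \<noteq> {}" "num_range_ds V \<noteq> {}"
    unfolding num_range_ds_eq by blast+
  show ?thesis
  proof (rule hausdorff_dist_closure_le[OF ne])
    fix w assume "w \<in> num_range_ds U"
    then obtain x where x: "norm x = 1" "w = cinner (U x) x" unfolding num_range_ds_eq by blast
    then have "cinner (V x) x \<in> num_range_ds V" unfolding num_range_ds_eq by blast
    then show "infdist w (num_range_ds V) \<le> ?d"
      using near[OF x(1)] by (auto simp: x(2) intro: infdist_le2)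
  next
    fix w assume "w \<in> num_range_ds V"
    then obtain x where x: "norm x = 1" "w = cinner (V x) x" unfolding num_range_ds_eq by blast
    then have "cinner (U x) x \<in> num_range_ds U" unfolding num_range_ds_eq by blast
    then show "infdist w (num_range_ds U) \<le> ?d"
      using near[OF x(1)] by (auto simp: x(2) dist_commute intro: infdist_le2)
  qed
qed

section \<open>The wrapping property and the intersection formula\<close>

lemma dilation_in_half_plane:
  fixes T :: "'a::{complex_inner, complete_space} \<Rightarrow> 'a"
  assumes T: "class_C0N T CARD('n::finite)" and a: "a \<noteq> 0"
    and sub: "closure (num_range T) \<subseteq> {z. Re (a * z) < c}"
  shows "\<exists>U\<in>(dilations T :: ('a \<times> (complex ^ 'n::finite) \<Rightarrow> 'a \<times> (complex ^ 'n)) set).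
    closure (num_range_ds U) \<subseteq> {z. Re (a * z) < c}"
proof -
  have contr: "contraction T" and dim: "cdim_eq (defect_space T) CARD('n)"
    "cdim_eq (defect_space (adjoint T)) CARD('n)"
    using T by (auto simp: class_C0N_def)
  let ?A = "closure (num_range T)"
  have scale: "T (scaleC k x) = scaleC k (T x)" for k x
    using contr by (simp add: contraction_def bounded_op_def clinear_op_def)
  have le1: "cmod w \<le> 1" if "w \<in> num_range T" for w
  proof -
    obtain x where x: "norm x = 1" "w = cinner (T x) x" using \<open>w \<in> num_range T\<close> by (auto simp: num_range_def)
    have "norm (T x) \<le> 1" using contr x(1) unfolding contraction_def by metis
    then show ?thesis using cmod_cinner_le[of "T x" x] x by simp
  qed
  then have Asub: "?A \<subseteq> cball 0 1" by (intro closure_minimal) auto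
  then have comp: "compact ?A" using bounded_subset[OF bounded_cball] by (simp add: compact_eq_bounded_closed)
  have "?A \<noteq> {}" using num_range_nonempty[OF dim(1)] by simp
  moreover have "continuous_on ?A (\<lambda>z. Re (a * z))" by (intro continuous_intros)
  \<comment> \<open>By compactness the supremum is attained inside the open half-plane, which leaves
    a strict gap below \<open>c\<close>.\<close>
  ultimately obtain z0 where z0: "z0 \<in> ?A" "\<And>z. z \<in> ?A \<Longrightarrow> Re (a * z) \<le> Re (a * z0)"
    using continuous_attains_sup[OF comp] by blast
  have z0c: "Re (a * z0) < c" using z0(1) sub by auto
  have half: "closure (num_range_ds U) \<subseteq> {z. Re (a * z) < c}"
    if "\<And>z. norm z = 1 \<Longrightarrow> Re (a * cinner (U z) z) \<le> m" "m < c"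
    for m and U :: "'a \<times> (complex ^ 'n) \<Rightarrow> 'a \<times> (complex ^ 'n)"
  proof -
    have "closed {z. Re (a * z) \<le> m}" by (intro closed_Collect_le continuous_intros)
    then have "closure (num_range_ds U) \<subseteq> {z. Re (a * z) \<le> m}"
      using that(1) by (intro closure_minimal) (auto simp: num_range_ds_eq)
    then show ?thesis using that(2) by fastforce
  qed
  define \<omega> where "\<omega> = a / of_real (cmod a)"
  have \<omega>: "cmod \<omega> = 1" and a\<omega>: "a = of_real (cmod a) * \<omega>" using a by (simp_all add: \<omega>_def norm_divide)
  define c' where "c' = Re (\<omega> * z0)"
  have Re_a: "Re (a * z) = cmod a * Re (\<omega> * z)" for z
    by (subst a\<omega>) (simp add: mult.assoc)
  have Re_z0: "Re (a * z0) = cmod a * c'" unfolding c'_def by (rule Re_a)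
  have "\<bar>c'\<bar> \<le> cmod (\<omega> * z0)" unfolding c'_def by (rule abs_Re_le_cmod)
  also have "\<dots> \<le> 1" using z0(1) Asub \<omega> by (auto simp: norm_mult)
  finally have c': "\<bar>c'\<bar> \<le> 1" .
  show ?thesis
  proof (cases "c' = 1")
    case True
    \<comment> \<open>Here Re (a z) attains \<open>cmod a\<close> on the closure of the numerical
      range, so \<open>c\<close> exceeds \<open>cmod a\<close> and the half-plane contains the
      closed unit disc.\<close>
    obtain U :: "'a \<times> (complex ^ 'n) \<Rightarrow> 'a \<times> (complex ^ 'n)" where U: "U \<in> dilations T"
      using dilation_exists[OF contr dim] by blast
    obtain V where "adjoint_pair U V" and norm: "\<And>z. norm (U z) = norm z"
      using dilations_adjoint[OF U] by blast
    have "Re (a * cinner (U z) z) \<le> cmod a" if "norm z = 1" for z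
      using complex_Re_le_cmod[of "a * cinner (U z) z"] cmod_cinner_le[of "U z" z] that norm[of z]
        mult_left_mono[of "cmod (cinner (U z) z)" 1 "cmod a"] by (simp add: norm_mult)
    moreover have "cmod a < c" using z0c unfolding Re_z0 True by simp
    ultimately show ?thesis using half U by blast
  next
    case False
    \<comment> \<open>\<open>k\<close> is the bound for the normalised direction
      \<open>\<omega>\<close>. The value \<open>c1\<close> lies above \<open>c'\<close> for
      coercivity, below 1 so that its line meets the unit circle, and below \<open>k\<close> so that
      the closed half-plane it bounds fits into the open one.\<close>
    define k where "k = c / cmod a"
    define c1 where "c1 = (c' + min 1 k) / 2"
    have "c' < k" using z0c a unfolding Re_z0 by (simp add: k_def field_simps)
    then have c1: "c' < c1" "c1 < 1" "c1 < k" using False c' by (auto simp: c1_def)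
    \<comment> \<open>A point of the unit circle that \<open>\<omega>\<close> rotates onto the line
      Re z = \<open>c1\<close>.\<close>
    define \<mu> where "\<mu> = cnj \<omega> * Complex c1 (sqrt (1 - c1\<^sup>2))"
    have "\<omega> * cnj \<omega> = 1" using complex_norm_square[of \<omega>] \<omega> by simp
    then have \<omega>\<mu>: "\<omega> * \<mu> = Complex c1 (sqrt (1 - c1\<^sup>2))"
      by (simp add: \<mu>_def mult.assoc[symmetric])
    have "c1\<^sup>2 \<le> 1" using c1 c' by (simp add: abs_square_le_1)
    then have "cmod (Complex c1 (sqrt (1 - c1\<^sup>2))) = 1" by (simp add: cmod_def)
    then have \<mu>: "cmod \<mu> = 1" using \<omega> by (simp add: \<mu>_def norm_mult)
    have "Re (\<omega> * cinner (T x) x) \<le> (Re (\<omega> * \<mu>) - (c1 - c')) * (norm x)\<^sup>2" for x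
    proof (cases "x = 0")
      case False
      define u where "u = scaleC (of_real (1 / norm x)) x"
      have "norm u = 1" using False by (simp add: u_def norm_divide)
      then have A: "cinner (T u) u \<in> ?A"
        using closure_subset[of "num_range T"] by (auto simp: num_range_def)
      have "Re (\<omega> * cinner (T u) u) \<le> c'"
        using z0(2)[OF A] a unfolding Re_a c'_def
        by (auto intro: mult_left_le_imp_le[of "cmod a"] simp del: times_complex.sel)
      moreover have "x = scaleC (of_real (norm x)) u"
        using False by (simp add: u_def)
      then have "cinner (T x) x = of_real (norm x) * (of_real (norm x) * cinner (T u) u)"
        by (metis scale cinner_scaleC_left cinner_scaleC_right complex_cnj_complex_of_real)
      then have "\<omega> * cinner (T x) x = of_real ((norm x)\<^sup>2) * (\<omega> * cinner (T u) u)"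
        by (simp add: power2_eq_square)
      ultimately have "Re (\<omega> * cinner (T x) x) \<le> (norm x)\<^sup>2 * c'"
        by (simp only: Re_mult_of_real) (simp add: mult_left_mono del: times_complex.sel)
      then show ?thesis unfolding \<omega>\<mu> by (simp add: mult.commute del: times_complex.sel)
    qed simp
    then obtain U :: "'a \<times> (complex ^ 'n) \<Rightarrow> 'a \<times> (complex ^ 'n)" where U: "U \<in> dilations T"
      "\<And>z. Re (\<omega> * cinner (U z) z) \<le> Re (\<omega> * \<mu>) * (norm z)\<^sup>2"
      using half_plane_dilation[OF contr dim(1) \<omega> \<mu>, of "c1 - c'"] c1 by auto
    have "Re (a * cinner (U z) z) \<le> cmod a * c1" if "norm z = 1" for z
      using U(2)[of z] that unfolding Re_a \<omega>\<mu> by (simp add: mult_left_mono del: times_complex.sel)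
    moreover have "cmod a * c1 < c" using c1(3) a by (simp add: k_def field_simps)
    ultimately show ?thesis using half U(1) by blast
  qed
qed

theorem theorem4p8:
  fixes T :: "'a::{complex_inner, complete_space} \<Rightarrow> 'a"
  assumes "separable_space TYPE('a)"
    and "class_C0N T CARD('n::finite)"
  shows "wraps (\<lambda>U. closure (num_range_ds U))
               (dilations T :: ('a \<times> (complex^'n) \<Rightarrow> 'a \<times> (complex^'n)) set)
               (closure (num_range T))
       \<and> closure (num_range T)
           = (\<Inter>U\<in>(dilations T :: ('a \<times> (complex^'n) \<Rightarrow> 'a \<times> (complex^'n)) set).
                closure (num_range_ds U))"
proof (intro conjI)
  let ?D = "dilations T :: ('a \<times> (complex^'n) \<Rightarrow> 'a \<times> (complex^'n)) set"
  let ?A = "closure (num_range T)"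
  have wrap: "\<exists>U\<in>?D. closure (num_range_ds U) \<subseteq> {z. Re (a * z) < c}"
    if "a \<noteq> 0" "?A \<subseteq> {z. Re (a * z) < c}" for a c
    using dilation_in_half_plane[OF assms(2) that] .
  \<comment> \<open>The Lipschitz constant 1 allows \<delta> = \<epsilon>.\<close>
  have cont: "hausdorff_dist (closure (num_range_ds U)) (closure (num_range_ds V)) < \<epsilon>"
    if "U \<in> ?D" "V \<in> ?D" "onorm (\<lambda>x. U x - V x) < \<epsilon>" for U V \<epsilon>
    using hausdorff_dist_num_range_ds_le[of U V] dilations_bounded_linear that
    by (meson order.strict_trans1)
  show "wraps (\<lambda>U. closure (num_range_ds U)) ?D ?A"
    unfolding wraps_def using wrap cont by blast
  show "?A = (\<Inter>U\<in>?D. closure (num_range_ds U))"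
  proof (intro equalityI subsetI INT_I)
    fix z U assume "z \<in> ?A" and "U \<in> ?D"
    then show "z \<in> closure (num_range_ds U)"
      using closure_mono[OF num_range_subset_ds] by blast
  next
    fix z assume z: "z \<in> (\<Inter>U\<in>?D. closure (num_range_ds U))"
    show "z \<in> ?A"
    proof (rule ccontr)
      assume "z \<notin> ?A"
      moreover have "convex ?A"
        using assms(2) by (intro convex_closure convex_num_range)
          (simp add: class_C0N_def contraction_def bounded_op_def)
      ultimately obtain a b where ab: "inner a z < b" "\<And>w. w \<in> ?A \<Longrightarrow> inner a w > b"
        using separating_hyperplane_closed_point[OF _ closed_closure] by blast
      \<comment> \<open>The real inner product with a is Re (cnj a w); the sign turns the lower
        bound on the closed numerical range into the upper bound that \<open>wraps\<close>
        expects.\<close>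
      have Re_inner: "Re (- cnj a * w) = - inner a w" for w
        by (simp add: inner_complex_def)
      have sub: "?A \<subseteq> {w. Re (- cnj a * w) < - b}"
        using ab(2) unfolding Re_inner by auto
      \<comment> \<open>For a = 0 the separation would say 0 < b at z and 0 > b at any point of the
        closed numerical range, so one such point excludes it.\<close>
      have "num_range T \<noteq> {}"
        using assms(2) num_range_nonempty unfolding class_C0N_def by blast
      then have "a \<noteq> 0" using ab by fastforce
      then have "\<exists>U\<in>?D. closure (num_range_ds U) \<subseteq> {w. Re (- cnj a * w) < - b}"
        by (intro wrap sub) simp
      then show False using z ab(1) unfolding Re_inner by fastforce
    qed
  qed
qed

end
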